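(* Let $\mathcal H$ be a separable complex Hilbert space and $S_2$ the Hilbert space of Hilbert–Schmidt operators on $\mathcal H$ with $\langle\eta,\tau\rangle_2=\operatorname{tr}(\eta^*\tau)$. Every continuous sesquilinear form $\varphi:S_2\times S_2\to\mathbb C$ admits the representation $$\varphi(\eta,\tau)=\sum_n\operatorname{tr}(\eta^*a_n\tau b_n),\qquad\{a_n\},\{b_n\}\subset\mathcal B(\mathcal H),$$ where the linear operator $\tau\mapsto\sum_na_n\tau b_n$ belongs to $\mathcal B(S_2)$. Moreover, $\varphi$ is hermitian if and only if $a_1,a_2,\ldots,b_1,b_2,\ldots$ can be chosen selfadjoint.
   Context: Inner products are anti-linear in the left argument. A continuous sesquilinear form $\varphi$ on $S_2$ is called hermitian if the operator $T\in\mathcal B(S_2)$ with $\varphi(\eta,\tau)=\langle\eta,T\tau\rangle_2$ is selfadjoint. *)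

theory Defs
  imports "HOL-Analysis.Analysis"
begin

class complex_vector = real_vector +
  fixes scaleC :: "complex \<Rightarrow> 'a \<Rightarrow> 'a" (infixr \<open>*\<^sub>C\<close> 75)
  assumes scaleC_add_right: "a *\<^sub>C (x + y) = a *\<^sub>C x + a *\<^sub>C y"
    and scaleC_add_left: "(a + b) *\<^sub>C x = a *\<^sub>C x + b *\<^sub>C x"
    and scaleC_scaleC: "a *\<^sub>C (b *\<^sub>C x) = (a * b) *\<^sub>C x"
    and scaleC_one: "1 *\<^sub>C x = x"
    and scaleR_scaleC: "scaleR r x = complex_of_real r *\<^sub>C x"

class complex_normed_vector = complex_vector + real_normed_vector +
  assumes norm_scaleC: "norm (a *\<^sub>C x) = cmod a * norm x"

class complex_inner = complex_normed_vector +
  fixes cinner :: "'a \<Rightarrow> 'a \<Rightarrow> complex"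
  assumes cinner_commute: "cinner x y = cnj (cinner y x)"
    and cinner_add_right: "cinner x (y + z) = cinner x y + cinner x z"
    and cinner_scaleC_right: "cinner x (a *\<^sub>C y) = a * cinner x y"
    and cinner_self_norm: "cinner x x = complex_of_real ((norm x)\<^sup>2)"

class chilbert_space = complex_inner + complete_space

definition separable_type :: "'a::metric_space itself \<Rightarrow> bool" where
  "separable_type _ \<longleftrightarrow> (\<exists>D::'a set. countable D \<and> closure D = UNIV)"

definition bounded_op :: "('a::complex_normed_vector \<Rightarrow> 'a) \<Rightarrow> bool" where
  "bounded_op A \<longleftrightarrow> (\<forall>x y. A (x + y) = A x + A y) \<and> (\<forall>c x. A (c *\<^sub>C x) = c *\<^sub>C A x)
      \<and> (\<exists>K. \<forall>x. norm (A x) \<le> K * norm x)"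

definition adj :: "('a::complex_inner \<Rightarrow> 'a) \<Rightarrow> ('a \<Rightarrow> 'a)" where
  "adj A = (SOME B. \<forall>x y. cinner x (A y) = cinner (B x) y)"

definition selfadjoint_op :: "('a::complex_inner \<Rightarrow> 'a) \<Rightarrow> bool" where
  "selfadjoint_op A \<longleftrightarrow> bounded_op A \<and> (\<forall>x y. cinner (A x) y = cinner x (A y))"

definition cspan :: "'a::complex_vector set \<Rightarrow> 'a set" where
  "cspan B = {x. \<exists>F c. finite F \<and> F \<subseteq> B \<and> x = (\<Sum>e\<in>F. c e *\<^sub>C e)}"

definition is_onb :: "'a::complex_inner set \<Rightarrow> bool" where
  "is_onb B \<longleftrightarrow> (\<forall>e\<in>B. norm e = 1) \<and> (\<forall>e\<in>B. \<forall>f\<in>B. e \<noteq> f \<longrightarrow> cinner e f = 0)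
      \<and> closure (cspan B) = UNIV"

definition the_onb :: "'a::complex_inner set" where
  "the_onb = (SOME B. is_onb B)"

text \<open>Trace (for trace-class operators it is independent of the orthonormal basis).\<close>
definition trace :: "('a::complex_inner \<Rightarrow> 'a) \<Rightarrow> complex" where
  "trace T = infsum (\<lambda>e. cinner e (T e)) the_onb"

definition hilbert_schmidt :: "('a::complex_inner \<Rightarrow> 'a) \<Rightarrow> bool" where
  "hilbert_schmidt A \<longleftrightarrow> bounded_op A \<and> (\<lambda>e. (norm (A e))\<^sup>2) summable_on the_onb"

definition hs_inner :: "('a::complex_inner \<Rightarrow> 'a) \<Rightarrow> ('a \<Rightarrow> 'a) \<Rightarrow> complex" where
  "hs_inner \<eta> \<tau> = trace (adj \<eta> \<circ> \<tau>)"

definition hs_norm :: "('a::complex_inner \<Rightarrow> 'a) \<Rightarrow> real" where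
  "hs_norm \<eta> = sqrt (Re (hs_inner \<eta> \<eta>))"

definition bounded_op_S2 :: "(('a::complex_inner \<Rightarrow> 'a) \<Rightarrow> ('a \<Rightarrow> 'a)) \<Rightarrow> bool" where
  "bounded_op_S2 T \<longleftrightarrow>
     (\<forall>\<tau>. hilbert_schmidt \<tau> \<longrightarrow> hilbert_schmidt (T \<tau>)) \<and>
     (\<forall>\<sigma> \<tau>. hilbert_schmidt \<sigma> \<longrightarrow> hilbert_schmidt \<tau> \<longrightarrow> T (\<lambda>x. \<sigma> x + \<tau> x) = (\<lambda>x. T \<sigma> x + T \<tau> x)) \<and>
     (\<forall>c \<tau>. hilbert_schmidt \<tau> \<longrightarrow> T (\<lambda>x. c *\<^sub>C \<tau> x) = (\<lambda>x. c *\<^sub>C T \<tau> x)) \<and>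
     (\<exists>K. \<forall>\<tau>. hilbert_schmidt \<tau> \<longrightarrow> hs_norm (T \<tau>) \<le> K * hs_norm \<tau>)"

definition selfadjoint_S2 :: "(('a::complex_inner \<Rightarrow> 'a) \<Rightarrow> ('a \<Rightarrow> 'a)) \<Rightarrow> bool" where
  "selfadjoint_S2 T \<longleftrightarrow> (\<forall>\<eta> \<tau>. hilbert_schmidt \<eta> \<longrightarrow> hilbert_schmidt \<tau> \<longrightarrow>
      hs_inner (T \<eta>) \<tau> = hs_inner \<eta> (T \<tau>))"

definition cont_sesq_form :: "(('a::complex_inner \<Rightarrow> 'a) \<Rightarrow> ('a \<Rightarrow> 'a) \<Rightarrow> complex) \<Rightarrow> bool" where
  "cont_sesq_form \<phi> \<longleftrightarrow>
     (\<forall>\<eta> \<eta>' \<tau>. hilbert_schmidt \<eta> \<longrightarrow> hilbert_schmidt \<eta>' \<longrightarrow> hilbert_schmidt \<tau> \<longrightarrow>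
        \<phi> (\<lambda>x. \<eta> x + \<eta>' x) \<tau> = \<phi> \<eta> \<tau> + \<phi> \<eta>' \<tau>) \<and>
     (\<forall>\<eta> \<tau> \<tau>'. hilbert_schmidt \<eta> \<longrightarrow> hilbert_schmidt \<tau> \<longrightarrow> hilbert_schmidt \<tau>' \<longrightarrow>
        \<phi> \<eta> (\<lambda>x. \<tau> x + \<tau>' x) = \<phi> \<eta> \<tau> + \<phi> \<eta> \<tau>') \<and>
     (\<forall>c \<eta> \<tau>. hilbert_schmidt \<eta> \<longrightarrow> hilbert_schmidt \<tau> \<longrightarrow>
        \<phi> (\<lambda>x. c *\<^sub>C \<eta> x) \<tau> = cnj c * \<phi> \<eta> \<tau>) \<and>
     (\<forall>c \<eta> \<tau>. hilbert_schmidt \<eta> \<longrightarrow> hilbert_schmidt \<tau> \<longrightarrow>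
        \<phi> \<eta> (\<lambda>x. c *\<^sub>C \<tau> x) = c * \<phi> \<eta> \<tau>) \<and>
     (\<exists>K. \<forall>\<eta> \<tau>. hilbert_schmidt \<eta> \<longrightarrow> hilbert_schmidt \<tau> \<longrightarrow>
        cmod (\<phi> \<eta> \<tau>) \<le> K * hs_norm \<eta> * hs_norm \<tau>)"

text \<open>Hermitian: the operator \<open>T \<in> B(S\<^sub>2)\<close> with \<open>\<phi>(\<eta>,\<tau>) = \<langle>\<eta>,T\<tau>\<rangle>\<^sub>2\<close> is selfadjoint
  (\<open>T\<close> is unique on \<open>S\<^sub>2\<close>, by Riesz).\<close>
definition hermitian_form :: "(('a::complex_inner \<Rightarrow> 'a) \<Rightarrow> ('a \<Rightarrow> 'a) \<Rightarrow> complex) \<Rightarrow> bool" where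
  "hermitian_form \<phi> \<longleftrightarrow> (\<exists>T. bounded_op_S2 T \<and> selfadjoint_S2 T \<and>
      (\<forall>\<eta> \<tau>. hilbert_schmidt \<eta> \<longrightarrow> hilbert_schmidt \<tau> \<longrightarrow> \<phi> \<eta> \<tau> = hs_inner \<eta> (T \<tau>)))"

text \<open>The representation \<open>\<phi>(\<eta>,\<tau>) = \<Sum>\<^sub>n tr(\<eta>\<^sup>* a\<^sub>n \<tau> b\<^sub>n)\<close>, where
  \<open>\<tau> \<mapsto> \<Sum>\<^sub>n a\<^sub>n \<tau> b\<^sub>n\<close> (weakly convergent in \<open>S\<^sub>2\<close>) is an operator \<open>T \<in> B(S\<^sub>2)\<close>.\<close>
definition sesq_rep ::
  "(('a::complex_inner \<Rightarrow> 'a) \<Rightarrow> ('a \<Rightarrow> 'a) \<Rightarrow> complex) \<Rightarrow> (nat \<Rightarrow> 'a \<Rightarrow> 'a) \<Rightarrow> (nat \<Rightarrow> 'a \<Rightarrow> 'a) \<Rightarrow> bool" where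
  "sesq_rep \<phi> a b \<longleftrightarrow> (\<forall>n. bounded_op (a n) \<and> bounded_op (b n)) \<and>
     (\<exists>T. bounded_op_S2 T \<and>
        (\<forall>\<eta> \<tau>. hilbert_schmidt \<eta> \<longrightarrow> hilbert_schmidt \<tau> \<longrightarrow>
           (\<lambda>n. trace (adj \<eta> \<circ> a n \<circ> \<tau> \<circ> b n)) sums (hs_inner \<eta> (T \<tau>)) \<and>
           (\<lambda>n. trace (adj \<eta> \<circ> a n \<circ> \<tau> \<circ> b n)) sums (\<phi> \<eta> \<tau>)))"

end

theory Submission
  imports Defs
begin

text \<open>Let \<open>E\<^sub>n = |e\<^sub>n\<rangle>\<langle>f\<^sub>n|\<close> enumerate the matrix units of \<open>S\<^sub>2\<close>. Truncating both arguments to the span of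
  \<open>E\<^sub>0, \<dots>, E\<^sub>N\<close> approximates \<open>\<phi>(\<eta>, \<tau>)\<close>, and for hermitian \<open>\<phi>\<close> the increments split into pairs
  \<open>t E\<^sub>m E\<^sub>N\<^sup>* + cnj t E\<^sub>N E\<^sub>m\<^sup>*\<close> of operators on \<open>S\<^sub>2\<close>, each of the form \<open>\<tau> \<mapsto> a \<tau> b + a\<^sup>* \<tau> b\<^sup>*\<close>. Taking real
  and imaginary parts of \<open>a\<close> and \<open>b\<close> makes this a difference of two terms with self-adjoint factors.
  The pairs are summed along square blocks; the partial sums inside a block, and the single terms of
  a pair, tend to zero because matrix coefficients are square summable. A general form is
  \<open>\<phi>\<^sub>1 + \<i> \<phi>\<^sub>2\<close> with \<open>\<phi>\<^sub>1\<close>, \<open>\<phi>\<^sub>2\<close> hermitian. The converse follows from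
  \<open>\<langle>\<eta>, a \<tau> b\<rangle>\<^sub>2 = \<langle>a \<eta> b, \<tau>\<rangle>\<^sub>2\<close> for self-adjoint \<open>a\<close>, \<open>b\<close>.\<close>

section \<open>Complex inner product spaces\<close>

text \<open>The matrix of a bounded operator on S_2 need not be absolutely summable, so the double
  series over pairs of matrix units has no unordered sum in general, and the order of its terms is
  part of the construction. A term with self-adjoint factors is by itself a hermitian form; an
  off-diagonal entry therefore cannot be listed alone and travels with its mirror image. The listing
  is that of \<open>prod_decode\<close>: read as \<open>(m, m + k)\<close>, an antidiagonal is the
  border that the square of side \<open>N + 1\<close> adds to the square of side \<open>N\<close>,
  where \<open>N = m + k\<close>. A partial sum is then a truncated form plus part of one border,
  and that part is again expressed by values of \<open>\<phi>\<close> on truncated arguments, so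
  continuity bounds it where absolute convergence could not. Since \<open>sesq_rep\<close> asks for
  convergence only against each fixed \<open>\<eta>\<close> and \<open>\<tau>\<close>, all series
  are scalar; the operator on S_2 comes from \<open>\<phi>\<close> by Riesz, independently of the
  series.\<close>

instance chilbert_space \<subseteq> banach ..

lemma cinner_add_left: "cinner (x + y) z = cinner x z + cinner y z"
  by (metis cinner_add_right cinner_commute complex_cnj_add)

lemma cinner_scaleC_left: "cinner (a *\<^sub>C x) y = cnj a * cinner x y"
  by (metis cinner_commute cinner_scaleC_right complex_cnj_mult)

lemma cinner_scaleR_right: "cinner x (r *\<^sub>R y) = r *\<^sub>R cinner x y"
  by (simp add: scaleR_scaleC cinner_scaleC_right scaleR_conv_of_real)

lemma cinner_scaleR_left: "cinner (r *\<^sub>R x) y = r *\<^sub>R cinner x y"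
  by (simp add: scaleR_scaleC cinner_scaleC_left scaleR_conv_of_real)

lemma additive_cinner_right: "Modules.additive (cinner x)"
  by (simp add: Modules.additive_def cinner_add_right)

lemma additive_cinner_left: "Modules.additive (\<lambda>x. cinner x y)"
  by (simp add: Modules.additive_def cinner_add_left)

lemma Re_cinner_self: "Re (cinner x x) = (norm x)\<^sup>2"
  by (simp add: cinner_self_norm)

lemma cinner_cauchy_schwarz: "cmod (cinner x y) \<le> norm x * norm y"
proof (cases "y = 0")
  case True
  then show ?thesis
    using Modules.additive.zero[OF additive_cinner_right[of x]] by simp
next
  case False
  \<comment> \<open>\<open>c *\<^sub>C y\<close> is the orthogonal projection of \<open>x\<close>
    onto the line through \<open>y\<close>; the inequality says that what remains has nonnegative
    squared norm.\<close>
  define c where "c = cinner y x / of_real ((norm y)\<^sup>2)"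
  have ny: "complex_of_real ((norm y)\<^sup>2) \<noteq> 0" using False by simp
  have cy: "c * complex_of_real ((norm y)\<^sup>2) = cinner y x"
    unfolding c_def using ny by simp
  have cc: "cinner x y = cnj (cinner y x)" by (rule cinner_commute)
  have "cinner (x - c *\<^sub>C y) (x - c *\<^sub>C y)
      = cinner x x - c * cinner x y - cnj c * (cinner y x - c * cinner y y)"
    by (simp add: Modules.additive.diff[OF additive_cinner_right] Modules.additive.diff[OF additive_cinner_left]
        cinner_scaleC_left cinner_scaleC_right algebra_simps)
  also have "\<dots> = cinner x x - c * cinner x y"
    unfolding cinner_self_norm[of y] cy by simp
  also have "c * cinner x y = of_real ((cmod (cinner x y))\<^sup>2 / (norm y)\<^sup>2)"
    unfolding c_def cc complex_mod_cnj
    by (simp add: complex_norm_square[symmetric] mult.commute)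
  finally have "(norm (x - c *\<^sub>C y))\<^sup>2 = (norm x)\<^sup>2 - (cmod (cinner x y))\<^sup>2 / (norm y)\<^sup>2"
    unfolding cinner_self_norm by (metis of_real_diff of_real_eq_iff)
  then have "(cmod (cinner x y))\<^sup>2 / (norm y)\<^sup>2 \<le> (norm x)\<^sup>2"
    by (metis diff_ge_0_iff_ge zero_le_power2)
  then have "(cmod (cinner x y))\<^sup>2 \<le> (norm x * norm y)\<^sup>2"
    using False by (simp add: divide_le_eq power_mult_distrib)
  then show ?thesis
    by (rule power2_le_imp_le) simp
qed

interpretation cinner: bounded_bilinear "cinner :: 'a::complex_inner \<Rightarrow> 'a \<Rightarrow> complex"
  by unfold_locales
    (auto simp: cinner_add_left cinner_add_right cinner_scaleR_left cinner_scaleR_right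
      intro!: exI[of _ 1] cinner_cauchy_schwarz)

interpretation scaleC: bounded_bilinear "scaleC :: complex \<Rightarrow> 'a::complex_normed_vector \<Rightarrow> 'a"
  by unfold_locales
    (auto simp: scaleC_add_left scaleC_add_right scaleR_scaleC scaleC_scaleC norm_scaleC
      scaleR_conv_of_real mult.commute intro!: exI[of _ 1])

lemma norm_add_sq_orthogonal:
  assumes "cinner x y = 0"
  shows "(norm (x + y))\<^sup>2 = (norm x)\<^sup>2 + (norm y)\<^sup>2"
proof -
  have "cinner y x = 0" using assms by (metis cinner_commute complex_cnj_zero)
  then have "cinner (x + y) (x + y) = cinner x x + cinner y y"
    using assms by (simp add: cinner_add_left cinner_add_right)
  then show ?thesis by (metis Re_cinner_self plus_complex.sel(1))
qed

lemma cinner_ext: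
  assumes "\<And>z. cinner z x = cinner z y"
  shows "x = y"
proof -
  have "cinner (x - y) (x - y) = 0"
    using assms[of "x - y"] by (simp add: cinner.diff_right)
  then show ?thesis by (simp add: cinner_self_norm)
qed

section \<open>Orthonormal bases\<close>

definition orthonormal :: "'a::complex_inner set \<Rightarrow> bool" where
  "orthonormal B \<longleftrightarrow> (\<forall>e\<in>B. norm e = 1) \<and> (\<forall>e\<in>B. \<forall>f\<in>B. e \<noteq> f \<longrightarrow> cinner e f = 0)"

lemma is_onb_alt: "is_onb B \<longleftrightarrow> orthonormal B \<and> closure (cspan B) = UNIV"
  by (auto simp: is_onb_def orthonormal_def)

lemma orthonormal_cinner:
  assumes "orthonormal B" "e \<in> B" "f \<in> B"
  shows "cinner e f = (if e = f then 1 else 0)"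
  using assms by (auto simp: orthonormal_def cinner_self_norm)

lemma cinner_sum_orthonormal:
  assumes "orthonormal B" "finite F" "F \<subseteq> B" "e \<in> B"
  shows "cinner e (\<Sum>f\<in>F. c f *\<^sub>C f) = (if e \<in> F then c e else 0)"
proof -
  have "cinner e (\<Sum>f\<in>F. c f *\<^sub>C f) = (\<Sum>f\<in>F. if e = f then c f else 0)"
    unfolding cinner.sum_right
    by (rule sum.cong) (use assms in \<open>auto simp: cinner_scaleC_right orthonormal_cinner[OF assms(1)]\<close>)
  then show ?thesis using assms(2) by simp
qed

lemma norm_sum_orthonormal:
  assumes "orthonormal B" "finite F" "F \<subseteq> B"
  shows "(norm (\<Sum>f\<in>F. c f *\<^sub>C f))\<^sup>2 = (\<Sum>f\<in>F. (cmod (c f))\<^sup>2)"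
  using assms(2,3)
proof (induction F rule: finite_induct)
  case (insert x F)
  have "cinner x (\<Sum>f\<in>F. c f *\<^sub>C f) = 0"
    using insert cinner_sum_orthonormal[OF assms(1) insert(1), of x c] by simp
  then have "cinner (c x *\<^sub>C x) (\<Sum>f\<in>F. c f *\<^sub>C f) = 0"
    by (simp add: cinner_scaleC_left)
  moreover have "norm x = 1" using insert assms(1) by (auto simp: orthonormal_def)
  ultimately show ?case
    using insert by (simp add: norm_add_sq_orthogonal norm_scaleC)
qed simp

lemma bessel_finite:
  assumes "orthonormal B" "finite F" "F \<subseteq> B"
  shows "(\<Sum>e\<in>F. (cmod (cinner e x))\<^sup>2) \<le> (norm x)\<^sup>2"
proof -
  define p where "p = (\<Sum>f\<in>F. cinner f x *\<^sub>C f)"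
  have "cinner p (x - p) = (\<Sum>f\<in>F. cnj (cinner f x) * cinner f (x - p))"
    unfolding p_def cinner.sum_left by (simp add: cinner_scaleC_left)
  also have "\<dots> = 0"
  proof (rule sum.neutral, rule ballI)
    fix f assume "f \<in> F"
    then show "cnj (cinner f x) * cinner f (x - p) = 0"
      unfolding p_def cinner.diff_right
      using cinner_sum_orthonormal[OF assms, of f "\<lambda>f. cinner f x"] assms(3) by auto
  qed
  finally have "(norm (p + (x - p)))\<^sup>2 = (norm p)\<^sup>2 + (norm (x - p))\<^sup>2"
    by (rule norm_add_sq_orthogonal)
  then have "(norm p)\<^sup>2 \<le> (norm x)\<^sup>2" by simp
  then show ?thesis
    unfolding p_def norm_sum_orthonormal[OF assms] .
qed

lemma bessel_summable:
  assumes "orthonormal B"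
  shows "(\<lambda>e. (cmod (cinner e x))\<^sup>2) summable_on B"
  by (rule nonneg_bdd_above_summable_on)
    (auto intro!: bdd_aboveI2[where M = "(norm x)\<^sup>2"] bessel_finite[OF assms])

text \<open>Riesz-Fischer: the squared distance between the sums over \<open>F0\<close> and over a
  larger \<open>F\<close> is the part of the scalar series carried by \<open>F - F0\<close>. So the
  net of finite sums is Cauchy, and completeness gives the limit.\<close>

lemma orthonormal_series_summable:
  fixes B :: "'a::chilbert_space set"
  assumes B: "orthonormal B" and c: "(\<lambda>e. (cmod (c e))\<^sup>2) summable_on B"
  shows "(\<lambda>e. c e *\<^sub>C e) summable_on B"
proof -
  let ?g = "\<lambda>e. (cmod (c e))\<^sup>2" and ?f = "\<lambda>e. c e *\<^sub>C e"
  have "\<exists>P. eventually P (finite_subsets_at_top B) \<and>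
      (\<forall>F F'. P F \<and> P F' \<longrightarrow> dist (sum ?f F) (sum ?f F') < r)" if "r > 0" for r
  proof -
    \<comment> \<open>Scalar sums measure squared distances, hence the squared tolerance; thirds
      leave room for a strict inequality.\<close>
    obtain F0 where F0: "finite F0" "F0 \<subseteq> B" "dist (sum ?g F0) (infsum ?g B) \<le> (r/3)\<^sup>2"
      using has_sum_finite_approximation[OF has_sum_infsum[OF c], of "(r/3)\<^sup>2"] \<open>r > 0\<close> by auto
    define P where "P F \<longleftrightarrow> finite F \<and> F0 \<subseteq> F \<and> F \<subseteq> B" for F
    have near: "dist (sum ?f F) (sum ?f F0) \<le> r/3" if "P F" for F
    proof -
      have F: "finite F" "F0 \<subseteq> F" "F \<subseteq> B" using that by (auto simp: P_def)
      have "(dist (sum ?f F) (sum ?f F0))\<^sup>2 = (norm (sum ?f (F - F0)))\<^sup>2"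
        unfolding dist_norm using F by (simp add: sum_diff)
      also have "\<dots> = sum ?g (F - F0)"
        using F by (intro norm_sum_orthonormal[OF B]) auto
      also have "\<dots> = sum ?g F - sum ?g F0"
        using F by (simp add: sum_diff)
      also have "sum ?g F \<le> infsum ?g B"
        by (rule finite_sum_le_infsum[OF c]) (use F in auto)
      finally have "(dist (sum ?f F) (sum ?f F0))\<^sup>2 \<le> (r/3)\<^sup>2"
        using F0(3) by (simp add: dist_real_def)
      then show ?thesis by (rule power2_le_imp_le) (use \<open>r > 0\<close> in simp)
    qed
    have "dist (sum ?f F) (sum ?f F') < r" if "P F" "P F'" for F F'
      using near[OF that(1)] near[OF that(2)] \<open>r > 0\<close>
        dist_triangle2[of "sum ?f F" "sum ?f F'" "sum ?f F0"] by linarith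
    moreover have "eventually P (finite_subsets_at_top B)"
      unfolding eventually_finite_subsets_at_top P_def using F0 by auto
    ultimately show ?thesis by blast
  qed
  then have "cauchy_filter (filtermap (sum ?f) (finite_subsets_at_top B))"
    by (simp add: cauchy_filter_metric_filtermap)
  moreover have "complete (UNIV::'a set)"
    by (meson Cauchy_convergent UNIV_I complete_def convergent_def)
  ultimately obtain L where "(sum ?f \<longlongrightarrow> L) (finite_subsets_at_top B)"
    using complete_uniform[where S=UNIV] by (force simp add: filterlim_def)
  then show ?thesis
    using summable_on_def has_sum_def by blast
qed

lemma cinner_has_sum_orthonormal:
  assumes "orthonormal B" "e \<in> B" "((\<lambda>f. c f *\<^sub>C f) has_sum s) B"
  shows "cinner e s = c e"
proof -
  have "((\<lambda>f. cinner e (c f *\<^sub>C f)) has_sum cinner e s) B"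
    by (rule has_sum_bounded_linear[OF cinner.bounded_linear_right assms(3)])
  moreover have "((\<lambda>f. cinner e (c f *\<^sub>C f)) has_sum c e) B"
  proof -
    have "((\<lambda>f. if f = e then c e else 0) has_sum c e) {e}"
      by (rule has_sum_finiteI) auto
    then show ?thesis
      by (rule has_sum_cong_neutral[THEN iffD1, rotated -1])
        (use assms in \<open>auto simp: cinner_scaleC_right orthonormal_cinner[OF assms(1)]\<close>)
  qed
  ultimately show ?thesis by (rule has_sum_unique)
qed

text \<open>The vectors orthogonal to \<open>z\<close> form a closed set that contains the span of
  \<open>B\<close>, hence everything, hence \<open>z\<close> itself.\<close>

lemma onb_orthogonal_zero:
  assumes "is_onb B" "\<And>e. e \<in> B \<Longrightarrow> cinner e z = 0"
  shows "z = 0"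
proof -
  have "cspan B \<subseteq> {w. cinner w z = 0}"
    using assms(2)
    by (fastforce simp: cspan_def cinner.sum_left cinner_scaleC_left intro: sum.neutral)
  moreover have "closed {w. cinner w z = 0}"
    by (intro closed_Collect_eq linear_continuous_on cinner.bounded_linear_left continuous_on_const)
  ultimately have "closure (cspan B) \<subseteq> {w. cinner w z = 0}"
    by (rule closure_minimal)
  then have "cinner z z = 0"
    using assms(1) by (auto simp: is_onb_def)
  then show ?thesis by (simp add: cinner_self_norm)
qed

text \<open>Bessel and Riesz-Fischer provide some sum \<open>s\<close>; continuity gives it the
  coefficients of \<open>x\<close>, so \<open>x - s\<close> is orthogonal to the whole
  basis.\<close>

lemma onb_expansion:
  fixes B :: "'a::chilbert_space set"
  assumes "is_onb B"
  shows "((\<lambda>e. cinner e x *\<^sub>C e) has_sum x) B"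
proof -
  have B: "orthonormal B" using assms by (simp add: is_onb_alt)
  obtain s where s: "((\<lambda>e. cinner e x *\<^sub>C e) has_sum s) B"
    using orthonormal_series_summable[OF B bessel_summable[OF B]] by (auto simp: summable_on_def)
  have "x - s = 0"
    by (rule onb_orthogonal_zero[OF assms])
      (simp add: cinner.diff_right cinner_has_sum_orthonormal[OF B _ s])
  with s show ?thesis by simp
qed

lemma parseval:
  fixes B :: "'a::chilbert_space set"
  assumes "is_onb B"
  shows "((\<lambda>e. cinner x e * cinner e y) has_sum cinner x y) B"
  using has_sum_bounded_linear[OF cinner.bounded_linear_right onb_expansion[OF assms], of x y]
  by (simp add: cinner_scaleC_right mult.commute)

lemma cinner_mult_commute: "cinner x e * cinner e x = of_real ((cmod (cinner e x))\<^sup>2)"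
  by (metis cinner_commute complex_norm_square mult.commute)

lemma parseval_norm:
  fixes B :: "'a::chilbert_space set"
  assumes "is_onb B"
  shows "((\<lambda>e. (cmod (cinner e x))\<^sup>2) has_sum (norm x)\<^sup>2) B"
  using parseval[OF assms, of x x]
  unfolding cinner_mult_commute cinner_self_norm has_sum_of_real_iff .

section \<open>Existence and countability of orthonormal bases\<close>

lemma orthonormal_Union_chain:
  assumes "C \<in> chains {B. orthonormal B}"
  shows "orthonormal (\<Union>C)"
proof -
  have *: "orthonormal X" if "X \<in> C" for X
    using assms that by (auto simp: chains_def)
  show ?thesis
    unfolding orthonormal_def
  proof (intro conjI ballI impI)
    fix e assume "e \<in> \<Union>C"
    then show "norm e = 1" using * by (auto simp: orthonormal_def)
  next
    fix e f assume "e \<in> \<Union>C" "f \<in> \<Union>C" and ne: "e \<noteq> f"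
    then obtain X Y where XY: "X \<in> C" "Y \<in> C" "e \<in> X" "f \<in> Y" by blast
    then have "X \<subseteq> Y \<or> Y \<subseteq> X"
      using assms by (auto simp: chains_def chain_subset_def)
    then show "cinner e f = 0"
      using XY * ne by (metis orthonormal_def subsetD)
  qed
qed

text \<open>\<open>the_onb\<close> is a mere choice, so \<open>trace\<close> has no content until
  some basis exists. A maximal orthonormal set is one: were \<open>x\<close> different from its
  series \<open>s\<close>, the normalised remainder \<open>d\<close> could be adjoined.\<close>

lemma ex_onb: "\<exists>B::'a::chilbert_space set. is_onb B"
proof -
  have "\<exists>M\<in>{B::'a set. orthonormal B}. \<forall>X\<in>{B. orthonormal B}. M \<subseteq> X \<longrightarrow> X = M"
    by (rule Zorn_Lemma) (use orthonormal_Union_chain in blast)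
  then obtain M :: "'a set" where M: "orthonormal M"
    and max: "\<And>X. orthonormal X \<Longrightarrow> M \<subseteq> X \<Longrightarrow> X = M" by auto
  have "x \<in> closure (cspan M)" for x
  proof -
    obtain s where s: "((\<lambda>e. cinner e x *\<^sub>C e) has_sum s) M"
      using orthonormal_series_summable[OF M bessel_summable[OF M]] by (auto simp: summable_on_def)
    have "x = s"
    proof (rule ccontr)
      assume "x \<noteq> s"
      define d where "d = (1 / norm (x - s)) *\<^sub>R (x - s)"
      have d: "norm d = 1" unfolding d_def using \<open>x \<noteq> s\<close> by simp
      have orth: "cinner e d = 0" if "e \<in> M" for e
        unfolding d_def cinner_scaleR_right cinner.diff_right
        using cinner_has_sum_orthonormal[OF M that s] by simp
      have orth': "cinner d e = 0" if "e \<in> M" for e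
        by (metis orth[OF that] cinner_commute complex_cnj_zero)
      have "orthonormal (insert d M)"
        using M d orth orth' by (auto simp: orthonormal_def)
      then have "d \<in> M" using max by blast
      then have "cinner d d = 0" by (rule orth)
      then show False using d by (simp add: cinner_self_norm)
    qed
    have "x \<in> closure (cspan M)"
      unfolding closure_approachable
    proof (intro allI impI)
      fix r :: real assume "r > 0"
      then obtain F where "finite F" "F \<subseteq> M" "dist (\<Sum>e\<in>F. cinner e x *\<^sub>C e) s \<le> r/2"
        using has_sum_finite_approximation[OF s, of "r/2"] by auto
      then show "\<exists>y\<in>cspan M. dist y x < r"
        using \<open>r > 0\<close> \<open>x = s\<close> by (intro bexI[of _ "\<Sum>e\<in>F. cinner e x *\<^sub>C e"]) (auto simp: cspan_def)
    qed
    then show ?thesis .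
  qed
  then show ?thesis using M by (auto simp: is_onb_alt)
qed

lemma is_onb_the_onb: "is_onb (the_onb :: 'a::chilbert_space set)"
  unfolding the_onb_def by (rule someI_ex[OF ex_onb])

lemma orthonormal_the_onb: "orthonormal (the_onb :: 'a::chilbert_space set)"
  using is_onb_the_onb[where 'a = 'a] by (simp add: is_onb_alt)

text \<open>Distinct members lie at distance \<open>sqrt 2\<close>, so a point within 1/2 of a
  member, taken from a countable dense set, determines this member.\<close>

lemma orthonormal_countable:
  fixes B :: "'a::complex_inner set"
  assumes "separable_type TYPE('a)" "orthonormal B"
  shows "countable B"
proof -
  obtain D :: "'a set" where D: "countable D" "closure D = UNIV"
    using assms(1) by (auto simp: separable_type_def)
  have "\<forall>e. \<exists>d\<in>D. dist d e < 1/2"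
    using D(2) closure_approachable[of _ D] by (metis UNIV_I half_gt_zero zero_less_one)
  then obtain d where d: "\<And>e. d e \<in> D" "\<And>e. dist (d e) e < 1/2" by metis
  have "inj_on d B"
  proof (rule inj_onI, rule ccontr)
    fix e f assume ef: "e \<in> B" "f \<in> B" "d e = d f" "e \<noteq> f"
    have "dist e f < 1"
      using d(2)[of e] d(2)[of f] ef(3) dist_triangle3[of e f "d e"] by simp
    then have "(norm (e + - f))\<^sup>2 < 1"
      by (simp add: dist_norm power_less_one_iff)
    moreover have "(norm (e + - f))\<^sup>2 = (norm e)\<^sup>2 + (norm (- f))\<^sup>2"
      by (rule norm_add_sq_orthogonal)
        (use ef assms(2) in \<open>auto simp: cinner.minus_right orthonormal_def\<close>)
    ultimately show False
      using ef assms(2) by (auto simp: orthonormal_def)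
  qed
  moreover have "countable (d ` B)"
    using D(1) d(1) by (meson countable_subset image_subsetI)
  ultimately show ?thesis
    using countable_image_inj_on by blast
qed

text \<open>The coordinates of \<open>v\<close> can only be \<open>cnj (f e)\<close>. They are
  square summable because \<open>f\<close> is tested on the finite sums \<open>u\<close> built from
  them: \<open>f u\<close> is the squared norm of \<open>u\<close>, which is therefore at most
  \<open>norm u * K\<close>.\<close>

lemma riesz_representation:
  fixes f :: "'a::chilbert_space \<Rightarrow> complex"
  assumes add: "\<And>x y. f (x + y) = f x + f y"
    and scale: "\<And>c x. f (c *\<^sub>C x) = c * f x"
    and bound: "\<And>x. cmod (f x) \<le> norm x * K"
  shows "\<exists>v. \<forall>x. f x = cinner v x"
proof -
  let ?B = "the_onb :: 'a set"
  have lin: "bounded_linear f"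
    by (rule bounded_linear_intro[OF add _ bound])
      (simp add: scaleR_scaleC scale scaleR_conv_of_real)
  have sq: "(\<lambda>e. (cmod (cnj (f e)))\<^sup>2) summable_on ?B"
  proof (rule nonneg_bdd_above_summable_on)
    show "bdd_above (sum (\<lambda>e. (cmod (cnj (f e)))\<^sup>2) ` {F. F \<subseteq> ?B \<and> finite F})"
    proof (rule bdd_aboveI2)
      fix F assume F: "F \<in> {F. F \<subseteq> ?B \<and> finite F}"
      define u where "u = (\<Sum>e\<in>F. cnj (f e) *\<^sub>C e)"
      define S where "S = (\<Sum>e\<in>F. (cmod (cnj (f e)))\<^sup>2)"
      have nu: "(norm u)\<^sup>2 = S"
        unfolding u_def S_def by (rule norm_sum_orthonormal[OF orthonormal_the_onb]) (use F in auto)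
      have "f u = of_real S"
        unfolding u_def S_def bounded_linear.linear[OF lin, THEN linear_sum] of_real_sum
        by (rule sum.cong) (simp_all only: scale complex_mod_cnj complex_norm_square mult.commute)
      then have "(norm u)\<^sup>2 \<le> norm u * K"
        using bound[of u] nu abs_ge_self[of S] by simp
      then have "norm u \<le> K \<or> u = 0"
        by (auto simp: power2_eq_square)
      then have "(norm u)\<^sup>2 \<le> K\<^sup>2"
        by (auto intro: power_mono)
      then show "(\<Sum>e\<in>F. (cmod (cnj (f e)))\<^sup>2) \<le> K\<^sup>2" using nu S_def by simp
    qed
  qed simp
  obtain v where v: "((\<lambda>e. cnj (f e) *\<^sub>C e) has_sum v) ?B"
    using orthonormal_series_summable[OF orthonormal_the_onb sq] by (auto simp: summable_on_def)
  have ve: "cinner v e = f e" if "e \<in> ?B" for e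
    by (metis cinner_has_sum_orthonormal[OF orthonormal_the_onb that v] cinner_commute complex_cnj_cnj)
  have "f x = cinner v x" for x
  proof -
    note x = onb_expansion[OF is_onb_the_onb, of x]
    have "((\<lambda>e. f (cinner e x *\<^sub>C e)) has_sum f x) ?B"
      by (rule has_sum_bounded_linear[OF lin x])
    moreover have "((\<lambda>e. cinner v (cinner e x *\<^sub>C e)) has_sum cinner v x) ?B"
      by (rule has_sum_bounded_linear[OF cinner.bounded_linear_right x])
    then have "((\<lambda>e. f (cinner e x *\<^sub>C e)) has_sum cinner v x) ?B"
      by (rule has_sum_cong[THEN iffD1, rotated]) (simp add: scale cinner_scaleC_right ve)
    ultimately show ?thesis by (rule has_sum_unique)
  qed
  then show ?thesis by blast
qed

section \<open>Bounded operators and adjoints\<close>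

lemma bounded_opI:
  assumes "\<And>x y. A (x + y) = A x + A y" "\<And>c x. A (c *\<^sub>C x) = c *\<^sub>C A x"
    "\<And>x. norm (A x) \<le> K * norm x"
  shows "bounded_op A"
  using assms by (auto simp: bounded_op_def)

lemma bounded_op_add: "bounded_op A \<Longrightarrow> A (x + y) = A x + A y"
  and bounded_op_scaleC: "bounded_op A \<Longrightarrow> A (c *\<^sub>C x) = c *\<^sub>C A x"
  by (auto simp: bounded_op_def)

lemma bounded_op_bound:
  assumes "bounded_op A"
  obtains K where "K \<ge> 0" "\<And>x. norm (A x) \<le> K * norm x"
proof -
  obtain K where "\<And>x. norm (A x) \<le> K * norm x" using assms by (auto simp: bounded_op_def)
  then have "norm (A x) \<le> max K 0 * norm x" for x
    by (metis max.cobounded1 mult_right_mono norm_ge_zero order_trans)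
  then show ?thesis using that[of "max K 0"] by simp
qed

lemma bounded_op_comp:
  assumes "bounded_op A" "bounded_op B"
  shows "bounded_op (\<lambda>x. A (B x))"
proof -
  obtain K where K: "K \<ge> 0" "\<And>x. norm (A x) \<le> K * norm x" using bounded_op_bound[OF assms(1)] by blast
  obtain L where L: "L \<ge> 0" "\<And>x. norm (B x) \<le> L * norm x" using bounded_op_bound[OF assms(2)] by blast
  have "norm (A (B x)) \<le> K * L * norm x" for x
    using K(2)[of "B x"] mult_left_mono[OF L(2)[of x] K(1)] by (simp add: mult.assoc)
  then show ?thesis
    by (rule bounded_opI[rotated -1])
      (simp_all add: bounded_op_add[OF assms(1)] bounded_op_add[OF assms(2)]
        bounded_op_scaleC[OF assms(1)] bounded_op_scaleC[OF assms(2)])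
qed

lemma bounded_op_plus:
  assumes "bounded_op A" "bounded_op B"
  shows "bounded_op (\<lambda>x. A x + B x)"
proof -
  obtain K where K: "K \<ge> 0" "\<And>x. norm (A x) \<le> K * norm x" using bounded_op_bound[OF assms(1)] by blast
  obtain L where L: "L \<ge> 0" "\<And>x. norm (B x) \<le> L * norm x" using bounded_op_bound[OF assms(2)] by blast
  have "norm (A x + B x) \<le> (K + L) * norm x" for x
    using norm_triangle_le[OF add_mono[OF K(2)[of x] L(2)[of x]]] by (simp add: distrib_right)
  then show ?thesis
    by (rule bounded_opI[rotated -1])
      (simp_all add: bounded_op_add[OF assms(1)] bounded_op_add[OF assms(2)]
        bounded_op_scaleC[OF assms(1)] bounded_op_scaleC[OF assms(2)] scaleC_add_right)
qed

lemma bounded_op_mult: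
  assumes "bounded_op A"
  shows "bounded_op (\<lambda>x. c *\<^sub>C A x)"
proof -
  obtain K where K: "K \<ge> 0" "\<And>x. norm (A x) \<le> K * norm x" using bounded_op_bound[OF assms(1)] by blast
  have "norm (c *\<^sub>C A x) \<le> (cmod c * K) * norm x" for x
    using mult_left_mono[OF K(2)[of x], of "cmod c"] by (simp add: norm_scaleC mult.assoc)
  then show ?thesis
    by (rule bounded_opI[rotated -1])
      (simp_all add: bounded_op_add[OF assms] bounded_op_scaleC[OF assms] scaleC_add_right
        scaleC_scaleC mult.commute)
qed

lemma ex_adjoint:
  fixes A :: "'a::chilbert_space \<Rightarrow> 'a"
  assumes "bounded_op A"
  shows "\<exists>B. \<forall>x y. cinner x (A y) = cinner (B x) y"
proof -
  obtain K where K: "K \<ge> 0" "\<And>x. norm (A x) \<le> K * norm x" using bounded_op_bound[OF assms] by blast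
  have "\<exists>v. \<forall>y. cinner x (A y) = cinner v y" for x
  proof (rule riesz_representation)
    show "cmod (cinner x (A y)) \<le> norm y * (norm x * K)" for y
      using cinner_cauchy_schwarz[of x "A y"] mult_left_mono[OF K(2)[of y], of "norm x"]
      by (simp add: mult_ac)
  qed (simp_all add: bounded_op_add[OF assms] bounded_op_scaleC[OF assms] cinner_add_right
      cinner_scaleC_right)
  then show ?thesis by metis
qed

lemma adj_left:
  fixes A :: "'a::chilbert_space \<Rightarrow> 'a"
  assumes "bounded_op A"
  shows "cinner (adj A x) y = cinner x (A y)"
proof -
  have "\<forall>x y. cinner x (A y) = cinner (adj A x) y"
    unfolding adj_def by (rule someI_ex[OF ex_adjoint[OF assms]])
  then show ?thesis by metis
qed

lemma adj_right:
  fixes A :: "'a::chilbert_space \<Rightarrow> 'a"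
  assumes "bounded_op A"
  shows "cinner x (adj A y) = cinner (A x) y"
  by (metis adj_left[OF assms] cinner_commute)

lemma bounded_op_adj:
  fixes A :: "'a::chilbert_space \<Rightarrow> 'a"
  assumes "bounded_op A"
  shows "bounded_op (adj A)"
proof -
  obtain K where K: "K \<ge> 0" "\<And>x. norm (A x) \<le> K * norm x" using bounded_op_bound[OF assms] by blast
  have "norm (adj A x) \<le> K * norm x" for x
  proof -
    \<comment> \<open>The squared norm is a pairing of \<open>A (adj A x)\<close> with
      \<open>x\<close>; one factor \<open>norm (adj A x)\<close> cancels in the end.\<close>
    have "(norm (adj A x))\<^sup>2 = cmod (cinner (A (adj A x)) x)"
      unfolding adj_right[OF assms, symmetric] cinner_self_norm norm_of_real by simp
    also have "\<dots> \<le> norm (A (adj A x)) * norm x" by (rule cinner_cauchy_schwarz)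
    also have "\<dots> \<le> K * norm (adj A x) * norm x" by (rule mult_right_mono[OF K(2)]) simp
    finally have "norm (adj A x) * norm (adj A x) \<le> norm (adj A x) * (K * norm x)"
      by (simp add: power2_eq_square mult_ac)
    then show ?thesis
      using K(1) by (cases "adj A x = 0") (auto simp: mult_le_cancel_left)
  qed
  then show ?thesis
    by (intro bounded_opI cinner_ext) (auto simp: adj_right[OF assms] cinner_add_right cinner_scaleC_right)
qed

lemma adj_eqI:
  fixes A :: "'a::chilbert_space \<Rightarrow> 'a"
  assumes "bounded_op A" "\<And>x y. cinner x (C y) = cinner (A x) y"
  shows "adj A = C"
  by (rule ext, rule cinner_ext) (simp add: adj_right[OF assms(1)] assms(2))

lemma adj_adj:
  fixes A :: "'a::chilbert_space \<Rightarrow> 'a"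
  assumes "bounded_op A"
  shows "adj (adj A) = A"
  by (rule adj_eqI[OF bounded_op_adj[OF assms]]) (simp add: adj_left[OF assms])

section \<open>Hilbert--Schmidt operators\<close>

lemma hs_bounded: "hilbert_schmidt A \<Longrightarrow> bounded_op A"
  by (simp add: hilbert_schmidt_def)

lemma hs_inner_eq:
  fixes \<eta> :: "'a::chilbert_space \<Rightarrow> 'a"
  assumes "bounded_op \<eta>"
  shows "hs_inner \<eta> \<tau> = infsum (\<lambda>e. cinner (\<eta> e) (\<tau> e)) the_onb"
  by (simp add: hs_inner_def trace_def adj_right[OF assms])

lemma summable_on_mult_square_summable:
  fixes f g :: "'i \<Rightarrow> real" and h :: "'i \<Rightarrow> complex"
  assumes "(\<lambda>i. (f i)\<^sup>2) summable_on A" "(\<lambda>i. (g i)\<^sup>2) summable_on A"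
    and "\<And>i. i \<in> A \<Longrightarrow> cmod (h i) \<le> f i * g i"
  shows "h summable_on A"
proof -
  have "(\<lambda>i. norm (h i)) summable_on A"
    using summable_on_add[OF assms(1,2)]
  proof (rule summable_on_comparison_test)
    fix i assume "i \<in> A"
    then show "norm (h i) \<le> (f i)\<^sup>2 + (g i)\<^sup>2"
      using assms(3)[of i] sum_squares_bound[of "f i" "g i"] zero_le_power2[of "f i"] zero_le_power2[of "g i"]
      by linarith
  qed simp
  then show ?thesis by (rule abs_summable_summable)
qed

lemma hs_inner_has_sum:
  fixes \<eta> :: "'a::chilbert_space \<Rightarrow> 'a"
  assumes "hilbert_schmidt \<eta>" "hilbert_schmidt \<tau>"
  shows "((\<lambda>e. cinner (\<eta> e) (\<tau> e)) has_sum hs_inner \<eta> \<tau>) the_onb"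
proof -
  have "(\<lambda>e. cinner (\<eta> e) (\<tau> e)) summable_on the_onb"
    by (rule summable_on_mult_square_summable[where f = "\<lambda>e. norm (\<eta> e)" and g = "\<lambda>e. norm (\<tau> e)"])
      (use assms in \<open>auto simp: hilbert_schmidt_def intro: cinner_cauchy_schwarz\<close>)
  then show ?thesis
    by (simp add: hs_inner_eq[OF hs_bounded[OF assms(1)]])
qed

lemma hs_norm_has_sum:
  fixes \<eta> :: "'a::chilbert_space \<Rightarrow> 'a"
  assumes "hilbert_schmidt \<eta>"
  shows "((\<lambda>e. (norm (\<eta> e))\<^sup>2) has_sum (hs_norm \<eta>)\<^sup>2) the_onb"
proof -
  have "((\<lambda>e. Re (cinner (\<eta> e) (\<eta> e))) has_sum Re (hs_inner \<eta> \<eta>)) the_onb"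
    by (rule has_sum_Re[OF hs_inner_has_sum[OF assms assms]])
  then have *: "((\<lambda>e. (norm (\<eta> e))\<^sup>2) has_sum Re (hs_inner \<eta> \<eta>)) the_onb"
    by (simp add: Re_cinner_self)
  moreover have "Re (hs_inner \<eta> \<eta>) \<ge> 0"
    by (rule has_sum_nonneg[OF *]) simp
  ultimately show ?thesis by (simp add: hs_norm_def)
qed

lemma hs_norm_eqI:
  fixes \<eta> :: "'a::chilbert_space \<Rightarrow> 'a"
  assumes "hilbert_schmidt \<eta>" "((\<lambda>e. (norm (\<eta> e))\<^sup>2) has_sum s) the_onb"
  shows "(hs_norm \<eta>)\<^sup>2 = s"
  by (rule has_sum_unique[OF hs_norm_has_sum[OF assms(1)] assms(2)])

lemma hs_norm_nonneg:
  fixes \<eta> :: "'a::chilbert_space \<Rightarrow> 'a"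
  assumes "hilbert_schmidt \<eta>"
  shows "hs_norm \<eta> \<ge> 0"
proof -
  have "Re (hs_inner \<eta> \<eta>) \<ge> 0"
    by (rule has_sum_nonneg[OF has_sum_Re[OF hs_inner_has_sum[OF assms assms]]])
      (simp add: Re_cinner_self)
  then show ?thesis by (simp add: hs_norm_def)
qed

lemma hs_inner_commute:
  fixes \<eta> :: "'a::chilbert_space \<Rightarrow> 'a"
  assumes "hilbert_schmidt \<eta>" "hilbert_schmidt \<tau>"
  shows "hs_inner \<eta> \<tau> = cnj (hs_inner \<tau> \<eta>)"
proof -
  have "((\<lambda>e. cnj (cinner (\<tau> e) (\<eta> e))) has_sum cnj (hs_inner \<tau> \<eta>)) the_onb"
    using hs_inner_has_sum[OF assms(2,1)] by simp
  then have "((\<lambda>e. cinner (\<eta> e) (\<tau> e)) has_sum cnj (hs_inner \<tau> \<eta>)) the_onb"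
    by (simp add: cinner_commute[symmetric])
  then show ?thesis by (rule has_sum_unique[OF hs_inner_has_sum[OF assms]])
qed

lemma hs_plus:
  fixes \<sigma> :: "'a::chilbert_space \<Rightarrow> 'a"
  assumes "hilbert_schmidt \<sigma>" "hilbert_schmidt \<tau>"
  shows "hilbert_schmidt (\<lambda>x. \<sigma> x + \<tau> x)"
proof -
  have "(\<lambda>e. 2 * (norm (\<sigma> e))\<^sup>2 + 2 * (norm (\<tau> e))\<^sup>2) summable_on the_onb"
    using assms by (intro summable_on_add summable_on_cmult_right) (auto simp: hilbert_schmidt_def)
  then have "(\<lambda>e. (norm (\<sigma> e + \<tau> e))\<^sup>2) summable_on the_onb"
  proof (rule summable_on_comparison_test)
    fix e
    have "(norm (\<sigma> e + \<tau> e))\<^sup>2 \<le> (norm (\<sigma> e) + norm (\<tau> e))\<^sup>2"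
      by (intro power_mono norm_triangle_ineq) simp
    also have "\<dots> \<le> 2 * (norm (\<sigma> e))\<^sup>2 + 2 * (norm (\<tau> e))\<^sup>2"
      using sum_squares_bound[of "norm (\<sigma> e)" "norm (\<tau> e)"] by (simp add: power2_sum)
    finally show "(norm (\<sigma> e + \<tau> e))\<^sup>2 \<le> 2 * (norm (\<sigma> e))\<^sup>2 + 2 * (norm (\<tau> e))\<^sup>2" .
  qed simp
  with assms show ?thesis by (simp add: hilbert_schmidt_def bounded_op_plus)
qed

lemma hs_comp_left:
  fixes \<tau> :: "'a::chilbert_space \<Rightarrow> 'a"
  assumes "bounded_op a" "hilbert_schmidt \<tau>"
  shows "hilbert_schmidt (\<lambda>x. a (\<tau> x))"
proof -
  obtain K where K: "K \<ge> 0" "\<And>x. norm (a x) \<le> K * norm x" using bounded_op_bound[OF assms(1)] by blast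
  have "(\<lambda>e. K\<^sup>2 * (norm (\<tau> e))\<^sup>2) summable_on the_onb"
    using assms(2) by (intro summable_on_cmult_right) (auto simp: hilbert_schmidt_def)
  then have "(\<lambda>e. (norm (a (\<tau> e)))\<^sup>2) summable_on the_onb"
  proof (rule summable_on_comparison_test)
    show "(norm (a (\<tau> e)))\<^sup>2 \<le> K\<^sup>2 * (norm (\<tau> e))\<^sup>2" for e
      using power_mono[OF K(2)[of "\<tau> e"], of 2] by (simp add: power_mult_distrib)
  qed simp
  with assms show ?thesis by (simp add: hilbert_schmidt_def bounded_op_comp)
qed

lemma bounded_op_id: "bounded_op (\<lambda>x. x)"
  by (rule bounded_opI[where K = 1]) auto

lemma hs_mult:
  fixes \<tau> :: "'a::chilbert_space \<Rightarrow> 'a"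
  assumes "hilbert_schmidt \<tau>"
  shows "hilbert_schmidt (\<lambda>x. c *\<^sub>C \<tau> x)"
  by (rule hs_comp_left[OF bounded_op_mult[OF bounded_op_id] assms])

lemma diff_eq_scaleC: "x - y = x + (- 1) *\<^sub>C (y :: 'a::complex_normed_vector)"
  by (simp add: scaleC.minus_left scaleC_one)

lemma hs_diff:
  fixes \<sigma> :: "'a::chilbert_space \<Rightarrow> 'a"
  assumes "hilbert_schmidt \<sigma>" "hilbert_schmidt \<tau>"
  shows "hilbert_schmidt (\<lambda>x. \<sigma> x - \<tau> x)"
  unfolding diff_eq_scaleC by (rule hs_plus[OF assms(1) hs_mult[OF assms(2)]])

lemma hs_zero: "hilbert_schmidt (\<lambda>x. 0 :: 'a::chilbert_space)"
  by (simp add: hilbert_schmidt_def bounded_op_def scaleC.zero_right exI[of _ 0])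

lemma hs_sum:
  fixes g :: "'i \<Rightarrow> 'a::chilbert_space \<Rightarrow> 'a"
  assumes "\<And>i. i \<in> F \<Longrightarrow> hilbert_schmidt (g i)"
  shows "hilbert_schmidt (\<lambda>x. \<Sum>i\<in>F. g i x)"
  using assms by (induction F rule: infinite_finite_induct) (auto intro: hs_plus hs_zero)

lemma hs_inner_add_right:
  fixes \<eta> :: "'a::chilbert_space \<Rightarrow> 'a"
  assumes "hilbert_schmidt \<eta>" "hilbert_schmidt \<sigma>" "hilbert_schmidt \<tau>"
  shows "hs_inner \<eta> (\<lambda>x. \<sigma> x + \<tau> x) = hs_inner \<eta> \<sigma> + hs_inner \<eta> \<tau>"
  using hs_inner_has_sum[OF assms(1) hs_plus[OF assms(2,3)]]
    has_sum_add[OF hs_inner_has_sum[OF assms(1,2)] hs_inner_has_sum[OF assms(1,3)]]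
  by (simp add: cinner_add_right has_sum_unique)

text \<open>Summed column by column this is Parseval for each \<open>\<eta> f\<close>. The double
  sum treats rows and columns alike, which the definition of \<open>hilbert_schmidt\<close> does
  not; taking adjoints becomes a swap of indices.\<close>

lemma hs_coeff_norm:
  fixes \<eta> :: "'a::chilbert_space \<Rightarrow> 'a"
  assumes "hilbert_schmidt \<eta>"
  shows "((\<lambda>(e, f). (cmod (cinner e (\<eta> f)))\<^sup>2) has_sum (hs_norm \<eta>)\<^sup>2) (the_onb \<times> the_onb)"
proof -
  let ?g = "\<lambda>(f, e). (cmod (cinner e (\<eta> f)))\<^sup>2"
  have inner: "((\<lambda>e. ?g (f, e)) has_sum (norm (\<eta> f))\<^sup>2) the_onb" for f
    using parseval_norm[OF is_onb_the_onb, of "\<eta> f"] by simp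
  have "?g summable_on (the_onb \<times> the_onb)"
    by (rule summable_on_SigmaI[where g = "\<lambda>f. (norm (\<eta> f))\<^sup>2"])
      (use inner assms in \<open>auto simp: hilbert_schmidt_def\<close>)
  then have "(?g has_sum (hs_norm \<eta>)\<^sup>2) (the_onb \<times> the_onb)"
    by (rule has_sum_SigmaI[OF inner hs_norm_has_sum[OF assms]])
  then show ?thesis by (subst has_sum_swap) simp
qed

lemma hs_coeff_inner:
  fixes \<eta> :: "'a::chilbert_space \<Rightarrow> 'a"
  assumes "hilbert_schmidt \<eta>" "hilbert_schmidt \<tau>"
  shows "((\<lambda>(e, f). cinner (\<eta> f) e * cinner e (\<tau> f)) has_sum hs_inner \<eta> \<tau>) (the_onb \<times> the_onb)"
proof -
  let ?g = "\<lambda>(f, e). cinner (\<eta> f) e * cinner e (\<tau> f)"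
  have "(\<lambda>(e, f). cinner (\<eta> f) e * cinner e (\<tau> f)) summable_on (the_onb \<times> the_onb)"
  proof (rule summable_on_mult_square_summable)
    show "(\<lambda>p. (case p of (e, f) \<Rightarrow> cmod (cinner e (\<eta> f)))\<^sup>2) summable_on (the_onb \<times> the_onb)"
      using hs_coeff_norm[OF assms(1)] by (simp add: case_prod_unfold has_sum_imp_summable)
    show "(\<lambda>p. (case p of (e, f) \<Rightarrow> cmod (cinner e (\<tau> f)))\<^sup>2) summable_on (the_onb \<times> the_onb)"
      using hs_coeff_norm[OF assms(2)] by (simp add: case_prod_unfold has_sum_imp_summable)
    have "cmod (cinner (\<eta> f) e) = cmod (cinner e (\<eta> f))" for e f
      by (metis cinner_commute complex_mod_cnj)
    then show "cmod (case p of (e, f) \<Rightarrow> cinner (\<eta> f) e * cinner e (\<tau> f))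
        \<le> (case p of (e, f) \<Rightarrow> cmod (cinner e (\<eta> f))) * (case p of (e, f) \<Rightarrow> cmod (cinner e (\<tau> f)))" for p
      by (cases p) (simp add: norm_mult)
  qed
  then have summable: "?g summable_on (the_onb \<times> the_onb)"
    by (subst summable_on_swap) simp
  have inner: "((\<lambda>e. ?g (f, e)) has_sum cinner (\<eta> f) (\<tau> f)) the_onb" for f
    using parseval[OF is_onb_the_onb] by simp
  have "(?g has_sum hs_inner \<eta> \<tau>) (the_onb \<times> the_onb)"
    by (rule has_sum_SigmaI[OF inner hs_inner_has_sum[OF assms] summable])
  then show ?thesis by (subst has_sum_swap) simp
qed

text \<open>The matrix of \<open>adj \<eta>\<close> is the conjugate transpose, so its columns are
  found in the same double family, now summed along rows.\<close>

lemma hs_adj: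
  fixes \<eta> :: "'a::chilbert_space \<Rightarrow> 'a"
  assumes "hilbert_schmidt \<eta>"
  shows "hilbert_schmidt (adj \<eta>)"
proof -
  have b: "bounded_op \<eta>" by (rule hs_bounded[OF assms])
  have "cmod (cinner e (\<eta> f)) = cmod (cinner f (adj \<eta> e))" for e f
    by (metis adj_left[OF b] cinner_commute complex_mod_cnj)
  then have "((\<lambda>(e, f). (cmod (cinner f (adj \<eta> e)))\<^sup>2) has_sum (hs_norm \<eta>)\<^sup>2) (the_onb \<times> the_onb)"
    using hs_coeff_norm[OF assms] by simp
  then have "((\<lambda>e. (norm (adj \<eta> e))\<^sup>2) has_sum (hs_norm \<eta>)\<^sup>2) the_onb"
    by (rule has_sum_SigmaD) (simp add: parseval_norm[OF is_onb_the_onb])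
  then show ?thesis
    by (simp add: hilbert_schmidt_def bounded_op_adj[OF b] has_sum_imp_summable)
qed

text \<open>Adjunction is antiunitary on S_2: both sides are one double sum over matrix entries,
  with the indices exchanged.\<close>

lemma hs_inner_adj:
  fixes \<eta> :: "'a::chilbert_space \<Rightarrow> 'a"
  assumes "hilbert_schmidt \<eta>" "hilbert_schmidt \<tau>"
  shows "hs_inner (adj \<tau>) (adj \<eta>) = hs_inner \<eta> \<tau>"
proof -
  have "((\<lambda>(e, f). cinner (adj \<tau> f) e * cinner e (adj \<eta> f)) has_sum hs_inner (adj \<tau>) (adj \<eta>)) (the_onb \<times> the_onb)"
    by (rule hs_coeff_inner[OF hs_adj[OF assms(2)] hs_adj[OF assms(1)]])
  then have "((\<lambda>(e, f). cinner (\<eta> f) e * cinner e (\<tau> f)) has_sum hs_inner (adj \<tau>) (adj \<eta>)) (the_onb \<times> the_onb)"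
    by (subst has_sum_swap)
      (simp add: adj_left[OF hs_bounded[OF assms(2)]] adj_right[OF hs_bounded[OF assms(1)]] mult.commute)
  then show ?thesis by (rule has_sum_unique[OF _ hs_coeff_inner[OF assms]])
qed

lemma adj_comp:
  fixes \<tau> :: "'a::chilbert_space \<Rightarrow> 'a"
  assumes "bounded_op \<tau>" "bounded_op b"
  shows "adj (\<lambda>x. \<tau> (b x)) = (\<lambda>x. adj b (adj \<tau> x))"
  by (rule adj_eqI[OF bounded_op_comp[OF assms]])
    (simp add: adj_right[OF assms(1)] adj_right[OF assms(2)])

text \<open>Square summability is tested on basis vectors, and \<open>b\<close> moves them out of
  the basis, so a right factor is not estimated directly. Passing to adjoints makes it a left
  factor.\<close>

lemma hs_comp_right:
  fixes \<tau> :: "'a::chilbert_space \<Rightarrow> 'a"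
  assumes "hilbert_schmidt \<tau>" "bounded_op b"
  shows "hilbert_schmidt (\<lambda>x. \<tau> (b x))"
proof -
  have t: "bounded_op \<tau>" by (rule hs_bounded[OF assms(1)])
  have "hilbert_schmidt (adj (\<lambda>x. \<tau> (b x)))"
    unfolding adj_comp[OF t assms(2)]
    by (rule hs_comp_left[OF bounded_op_adj[OF assms(2)] hs_adj[OF assms(1)]])
  then show ?thesis
    using hs_adj adj_adj[OF bounded_op_comp[OF t assms(2)]] by metis
qed

section \<open>Moving self-adjoint factors across the inner product of S_2\<close>

lemma selfadjoint_bounded: "selfadjoint_op a \<Longrightarrow> bounded_op a"
  by (simp add: selfadjoint_op_def)

lemma selfadjoint_adj:
  fixes a :: "'a::chilbert_space \<Rightarrow> 'a"
  assumes "selfadjoint_op a"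
  shows "adj a = a"
  by (rule adj_eqI) (use assms in \<open>auto simp: selfadjoint_op_def\<close>)

lemma hs_inner_selfadjoint_left:
  fixes \<eta> :: "'a::chilbert_space \<Rightarrow> 'a"
  assumes "bounded_op \<eta>" "selfadjoint_op a"
  shows "hs_inner \<eta> (\<lambda>x. a (\<tau> x)) = hs_inner (\<lambda>x. a (\<eta> x)) \<tau>"
  using assms
  by (simp add: hs_inner_eq bounded_op_comp selfadjoint_bounded) (simp add: selfadjoint_op_def)

text \<open>This is an instance of cyclicity of the trace, reached through adjunction, which turns
  the right factor into a left one and back.\<close>

lemma hs_inner_selfadjoint_right:
  fixes \<eta> :: "'a::chilbert_space \<Rightarrow> 'a"
  assumes "hilbert_schmidt \<eta>" "hilbert_schmidt \<tau>" "selfadjoint_op b"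
  shows "hs_inner \<eta> (\<lambda>x. \<tau> (b x)) = hs_inner (\<lambda>x. \<eta> (b x)) \<tau>"
proof -
  have b: "bounded_op b" by (rule selfadjoint_bounded[OF assms(3)])
  have "hs_inner \<eta> (\<lambda>x. \<tau> (b x)) = hs_inner (adj (\<lambda>x. \<tau> (b x))) (adj \<eta>)"
    by (rule hs_inner_adj[OF assms(1) hs_comp_right[OF assms(2) b], symmetric])
  also have "\<dots> = hs_inner (\<lambda>x. b (adj \<tau> x)) (adj \<eta>)"
    by (simp add: adj_comp hs_bounded assms b selfadjoint_adj)
  also have "\<dots> = hs_inner (adj \<tau>) (\<lambda>x. b (adj \<eta> x))"
    by (rule hs_inner_selfadjoint_left[OF bounded_op_adj[OF hs_bounded[OF assms(2)]] assms(3), symmetric])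
  also have "\<dots> = hs_inner (adj \<tau>) (adj (\<lambda>x. \<eta> (b x)))"
    by (simp add: adj_comp hs_bounded assms b selfadjoint_adj)
  also have "\<dots> = hs_inner (\<lambda>x. \<eta> (b x)) \<tau>"
    by (rule hs_inner_adj[OF hs_comp_right[OF assms(1) b] assms(2)])
  finally show ?thesis .
qed

lemma hs_inner_sandwich:
  fixes \<eta> :: "'a::chilbert_space \<Rightarrow> 'a"
  assumes "hilbert_schmidt \<eta>" "hilbert_schmidt \<tau>" "selfadjoint_op a" "selfadjoint_op b"
  shows "hs_inner \<eta> (\<lambda>x. a (\<tau> (b x))) = cnj (hs_inner \<tau> (\<lambda>x. a (\<eta> (b x))))"
proof -
  have ab: "bounded_op a" "bounded_op b" using assms selfadjoint_bounded by auto
  have "hs_inner \<eta> (\<lambda>x. a (\<tau> (b x))) = hs_inner (\<lambda>x. a (\<eta> x)) (\<lambda>x. \<tau> (b x))"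
    by (rule hs_inner_selfadjoint_left[OF hs_bounded[OF assms(1)] assms(3)])
  also have "\<dots> = hs_inner (\<lambda>x. a (\<eta> (b x))) \<tau>"
    by (rule hs_inner_selfadjoint_right[OF hs_comp_left[OF ab(1) assms(1)] assms(2,4)])
  also have "\<dots> = cnj (hs_inner \<tau> (\<lambda>x. a (\<eta> (b x))))"
    by (rule hs_inner_commute[OF hs_comp_left[OF ab(1) hs_comp_right[OF assms(1) ab(2)]] assms(2)])
  finally show ?thesis .
qed

text \<open>Turns the traces of the statement into inner products, so that the series are handled as
  weakly convergent ones in S_2.\<close>

lemma trace_eq_hs_inner: "trace (adj \<eta> \<circ> a \<circ> \<tau> \<circ> b) = hs_inner \<eta> (\<lambda>x. a (\<tau> (b x)))"
  by (simp add: hs_inner_def comp_def)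

subsection \<open>Rank one operators\<close>

definition rank1 :: "'a::complex_inner \<Rightarrow> 'a \<Rightarrow> 'a \<Rightarrow> 'a" where
  "rank1 y x = (\<lambda>v. cinner x v *\<^sub>C y)"

lemma rank1_add_left: "rank1 (y + y') x = (\<lambda>v. rank1 y x v + rank1 y' x v)"
  and rank1_scaleC_left: "rank1 (c *\<^sub>C y) x = (\<lambda>v. c *\<^sub>C rank1 y x v)"
  and rank1_add_right: "rank1 y (x + x') = (\<lambda>v. rank1 y x v + rank1 y x' v)"
  and rank1_scaleC_right: "rank1 y (c *\<^sub>C x) = (\<lambda>v. cnj c *\<^sub>C rank1 y x v)"
  by (simp_all add: rank1_def scaleC_add_right scaleC_add_left scaleC_scaleC cinner_add_left
      cinner_scaleC_left mult.commute)

lemma bounded_op_rank1: "bounded_op (rank1 y x)"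
proof (rule bounded_opI)
  show "norm (rank1 y x v) \<le> (norm x * norm y) * norm v" for v
    using mult_right_mono[OF cinner_cauchy_schwarz[of x v], of "norm y"]
    by (simp add: rank1_def norm_scaleC mult_ac)
qed (simp_all add: rank1_def cinner_add_right cinner_scaleC_right scaleC_add_left scaleC_scaleC)

lemma rank1_has_sum:
  fixes x y :: "'a::chilbert_space"
  shows "((\<lambda>e. (norm (rank1 y x e))\<^sup>2) has_sum (norm x * norm y)\<^sup>2) the_onb"
proof -
  have "cmod (cinner e x) = cmod (cinner x e)" for e
    by (metis cinner_commute complex_mod_cnj)
  then show ?thesis
    using has_sum_cmult_left[OF parseval_norm[OF is_onb_the_onb, of x], of "(norm y)\<^sup>2"]
    by (simp add: rank1_def norm_scaleC power_mult_distrib)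
qed

lemma hs_rank1: "hilbert_schmidt (rank1 y (x :: 'a::chilbert_space))"
  by (simp add: hilbert_schmidt_def bounded_op_rank1 has_sum_imp_summable[OF rank1_has_sum])

lemma hs_norm_rank1: "hs_norm (rank1 y (x :: 'a::chilbert_space)) = norm x * norm y"
  using hs_norm_eqI[OF hs_rank1 rank1_has_sum, of y x] hs_norm_nonneg[OF hs_rank1, of y x]
  by (simp add: power2_eq_iff_nonneg)

text \<open>The sum over the basis is Parseval for \<open>x\<close> and \<open>adj \<eta> y\<close>.
  For basis vectors it identifies inner products with matrix units as matrix entries, up to
  conjugation.\<close>

lemma hs_inner_rank1:
  fixes \<eta> :: "'a::chilbert_space \<Rightarrow> 'a"
  assumes "hilbert_schmidt \<eta>"
  shows "hs_inner \<eta> (rank1 y x) = cinner (\<eta> x) y"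
proof -
  have b: "bounded_op \<eta>" by (rule hs_bounded[OF assms])
  have "((\<lambda>e. cinner x e * cinner e (adj \<eta> y)) has_sum cinner x (adj \<eta> y)) the_onb"
    by (rule parseval[OF is_onb_the_onb])
  then have "((\<lambda>e. cinner (\<eta> e) (rank1 y x e)) has_sum cinner (\<eta> x) y) the_onb"
    by (simp add: rank1_def cinner_scaleC_right adj_right[OF b])
  then show ?thesis by (rule has_sum_unique[OF hs_inner_has_sum[OF assms hs_rank1]])
qed

section \<open>Continuous sesquilinear forms\<close>

lemma form_add_left:
  "cont_sesq_form \<phi> \<Longrightarrow> hilbert_schmidt \<eta> \<Longrightarrow> hilbert_schmidt \<eta>' \<Longrightarrow> hilbert_schmidt \<tau>
    \<Longrightarrow> \<phi> (\<lambda>x. \<eta> x + \<eta>' x) \<tau> = \<phi> \<eta> \<tau> + \<phi> \<eta>' \<tau>"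
  and form_add_right:
  "cont_sesq_form \<phi> \<Longrightarrow> hilbert_schmidt \<eta> \<Longrightarrow> hilbert_schmidt \<tau> \<Longrightarrow> hilbert_schmidt \<tau>'
    \<Longrightarrow> \<phi> \<eta> (\<lambda>x. \<tau> x + \<tau>' x) = \<phi> \<eta> \<tau> + \<phi> \<eta> \<tau>'"
  and form_scaleC_left:
  "cont_sesq_form \<phi> \<Longrightarrow> hilbert_schmidt \<eta> \<Longrightarrow> hilbert_schmidt \<tau>
    \<Longrightarrow> \<phi> (\<lambda>x. c *\<^sub>C \<eta> x) \<tau> = cnj c * \<phi> \<eta> \<tau>"
  and form_scaleC_right:
  "cont_sesq_form \<phi> \<Longrightarrow> hilbert_schmidt \<eta> \<Longrightarrow> hilbert_schmidt \<tau>
    \<Longrightarrow> \<phi> \<eta> (\<lambda>x. c *\<^sub>C \<tau> x) = c * \<phi> \<eta> \<tau>"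
  by (simp_all add: cont_sesq_form_def)

lemma form_bound:
  fixes \<phi> :: "('a::chilbert_space \<Rightarrow> 'a) \<Rightarrow> ('a \<Rightarrow> 'a) \<Rightarrow> complex"
  assumes "cont_sesq_form \<phi>"
  obtains K where "K \<ge> 0" "\<And>\<eta> \<tau>. hilbert_schmidt \<eta> \<Longrightarrow> hilbert_schmidt \<tau> \<Longrightarrow>
    cmod (\<phi> \<eta> \<tau>) \<le> K * hs_norm \<eta> * hs_norm \<tau>"
proof -
  have "\<exists>K. \<forall>\<eta> \<tau>. hilbert_schmidt \<eta> \<longrightarrow> hilbert_schmidt \<tau> \<longrightarrow>
      cmod (\<phi> \<eta> \<tau>) \<le> K * hs_norm \<eta> * hs_norm \<tau>"
    using assms unfolding cont_sesq_form_def by (elim conjE)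
  then obtain K where K: "\<forall>\<eta> \<tau>. hilbert_schmidt \<eta> \<longrightarrow> hilbert_schmidt \<tau> \<longrightarrow>
      cmod (\<phi> \<eta> \<tau>) \<le> K * hs_norm \<eta> * hs_norm \<tau>" ..
  have "cmod (\<phi> \<eta> \<tau>) \<le> max K 0 * hs_norm \<eta> * hs_norm \<tau>"
    if "hilbert_schmidt \<eta>" "hilbert_schmidt \<tau>" for \<eta> \<tau>
  proof -
    have "K * (hs_norm \<eta> * hs_norm \<tau>) \<le> max K 0 * (hs_norm \<eta> * hs_norm \<tau>)"
      by (rule mult_right_mono) (use that in \<open>auto simp: hs_norm_nonneg\<close>)
    then show ?thesis using K[rule_format, OF that] by (simp add: mult.assoc)
  qed
  then show ?thesis by (intro that[of "max K 0"]) auto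
qed

lemma form_zero_left:
  fixes \<phi> :: "('a::chilbert_space \<Rightarrow> 'a) \<Rightarrow> ('a \<Rightarrow> 'a) \<Rightarrow> complex"
  assumes "cont_sesq_form \<phi>" "hilbert_schmidt \<tau>"
  shows "\<phi> (\<lambda>x. 0) \<tau> = 0"
  using form_scaleC_left[OF assms(1) hs_zero assms(2), of 0] by (simp add: scaleC.zero_right)

lemma form_diff_left:
  fixes \<phi> :: "('a::chilbert_space \<Rightarrow> 'a) \<Rightarrow> ('a \<Rightarrow> 'a) \<Rightarrow> complex"
  assumes "cont_sesq_form \<phi>" "hilbert_schmidt \<eta>" "hilbert_schmidt \<eta>'" "hilbert_schmidt \<tau>"
  shows "\<phi> (\<lambda>x. \<eta> x - \<eta>' x) \<tau> = \<phi> \<eta> \<tau> - \<phi> \<eta>' \<tau>"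
  unfolding diff_eq_scaleC
  by (simp add: form_add_left[OF assms(1)] form_scaleC_left[OF assms(1)] assms hs_mult)

lemma form_sum_left:
  fixes \<phi> :: "('a::chilbert_space \<Rightarrow> 'a) \<Rightarrow> ('a \<Rightarrow> 'a) \<Rightarrow> complex"
  assumes "cont_sesq_form \<phi>" "hilbert_schmidt \<tau>" "\<And>i. i \<in> F \<Longrightarrow> hilbert_schmidt (g i)"
  shows "\<phi> (\<lambda>x. \<Sum>i\<in>F. g i x) \<tau> = (\<Sum>i\<in>F. \<phi> (g i) \<tau>)"
  using assms(3)
  by (induction F rule: infinite_finite_induct)
    (simp_all add: form_zero_left[OF assms(1,2)] form_add_left[OF assms(1)] hs_sum assms(2))

text \<open>The conjugate transpose of a form. It carries rules for the left argument over to the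
  right one, and the hermitian parts of a general form are built from it.\<close>

lemma cont_sesq_form_swap:
  fixes \<phi> :: "('a::chilbert_space \<Rightarrow> 'a) \<Rightarrow> ('a \<Rightarrow> 'a) \<Rightarrow> complex"
  assumes "cont_sesq_form \<phi>"
  shows "cont_sesq_form (\<lambda>\<eta> \<tau>. cnj (\<phi> \<tau> \<eta>))"
proof -
  obtain K where K: "K \<ge> 0" "\<And>\<eta> \<tau>. hilbert_schmidt \<eta> \<Longrightarrow> hilbert_schmidt \<tau> \<Longrightarrow>
    cmod (\<phi> \<eta> \<tau>) \<le> K * hs_norm \<eta> * hs_norm \<tau>"
    by (rule form_bound[OF assms], rule that)
  have "cmod (cnj (\<phi> \<tau> \<eta>)) \<le> K * hs_norm \<eta> * hs_norm \<tau>"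
    if "hilbert_schmidt \<eta>" "hilbert_schmidt \<tau>" for \<eta> \<tau>
    using K(2)[OF that(2,1)] by (simp add: mult_ac)
  then show ?thesis
    unfolding cont_sesq_form_def
    by (intro conjI allI impI exI[of _ K])
      (simp_all only: form_add_left[OF assms] form_add_right[OF assms] form_scaleC_left[OF assms]
        form_scaleC_right[OF assms] complex_cnj_add complex_cnj_mult complex_cnj_cnj)
qed

lemma form_diff_right:
  fixes \<phi> :: "('a::chilbert_space \<Rightarrow> 'a) \<Rightarrow> ('a \<Rightarrow> 'a) \<Rightarrow> complex"
  assumes "cont_sesq_form \<phi>" "hilbert_schmidt \<eta>" "hilbert_schmidt \<tau>" "hilbert_schmidt \<tau>'"
  shows "\<phi> \<eta> (\<lambda>x. \<tau> x - \<tau>' x) = \<phi> \<eta> \<tau> - \<phi> \<eta> \<tau>'"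
  using form_diff_left[OF cont_sesq_form_swap[OF assms(1)] assms(3,4,2)]
  by (simp only: complex_cnj_diff[symmetric] complex_cnj_cancel_iff)

lemma form_sum_right:
  fixes \<phi> :: "('a::chilbert_space \<Rightarrow> 'a) \<Rightarrow> ('a \<Rightarrow> 'a) \<Rightarrow> complex"
  assumes "cont_sesq_form \<phi>" "hilbert_schmidt \<eta>" "\<And>i. i \<in> F \<Longrightarrow> hilbert_schmidt (g i)"
  shows "\<phi> \<eta> (\<lambda>x. \<Sum>i\<in>F. g i x) = (\<Sum>i\<in>F. \<phi> \<eta> (g i))"
  using form_sum_left[OF cont_sesq_form_swap[OF assms(1)] assms(2,3)]
  by (simp only: cnj_sum[symmetric] complex_cnj_cancel_iff)

lemma cont_sesq_form_lincomb:
  fixes \<phi> \<psi> :: "('a::chilbert_space \<Rightarrow> 'a) \<Rightarrow> ('a \<Rightarrow> 'a) \<Rightarrow> complex"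
  assumes "cont_sesq_form \<phi>" "cont_sesq_form \<psi>"
  shows "cont_sesq_form (\<lambda>\<eta> \<tau>. a * \<phi> \<eta> \<tau> + b * \<psi> \<eta> \<tau>)"
proof -
  obtain K where K: "K \<ge> 0" "\<And>\<eta> \<tau>. hilbert_schmidt \<eta> \<Longrightarrow> hilbert_schmidt \<tau> \<Longrightarrow>
    cmod (\<phi> \<eta> \<tau>) \<le> K * hs_norm \<eta> * hs_norm \<tau>"
    by (rule form_bound[OF assms(1)], rule that)
  obtain L where L: "L \<ge> 0" "\<And>\<eta> \<tau>. hilbert_schmidt \<eta> \<Longrightarrow> hilbert_schmidt \<tau> \<Longrightarrow>
    cmod (\<psi> \<eta> \<tau>) \<le> L * hs_norm \<eta> * hs_norm \<tau>"
    by (rule form_bound[OF assms(2)], rule that)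
  have "cmod (a * \<phi> \<eta> \<tau> + b * \<psi> \<eta> \<tau>) \<le> (cmod a * K + cmod b * L) * hs_norm \<eta> * hs_norm \<tau>"
    if "hilbert_schmidt \<eta>" "hilbert_schmidt \<tau>" for \<eta> \<tau>
  proof -
    have "cmod (a * \<phi> \<eta> \<tau>) \<le> cmod a * (K * hs_norm \<eta> * hs_norm \<tau>)"
      unfolding norm_mult by (rule mult_left_mono[OF K(2)[OF that]]) simp
    moreover have "cmod (b * \<psi> \<eta> \<tau>) \<le> cmod b * (L * hs_norm \<eta> * hs_norm \<tau>)"
      unfolding norm_mult by (rule mult_left_mono[OF L(2)[OF that]]) simp
    ultimately show ?thesis
      by (intro norm_triangle_le) (simp add: algebra_simps)
  qed
  note bound = this
  note lin = form_add_left[OF assms(1)] form_add_right[OF assms(1)] form_scaleC_left[OF assms(1)]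
    form_scaleC_right[OF assms(1)] form_add_left[OF assms(2)] form_add_right[OF assms(2)]
    form_scaleC_left[OF assms(2)] form_scaleC_right[OF assms(2)]
  show ?thesis
    unfolding cont_sesq_form_def
  proof (intro conjI allI impI exI[of _ "cmod a * K + cmod b * L"])
    fix \<eta> \<tau> :: "'a \<Rightarrow> 'a" assume "hilbert_schmidt \<eta>" "hilbert_schmidt \<tau>"
    then show "cmod (a * \<phi> \<eta> \<tau> + b * \<psi> \<eta> \<tau>) \<le> (cmod a * K + cmod b * L) * hs_norm \<eta> * hs_norm \<tau>"
      by (rule bound)
  qed (simp_all only: lin distrib_left add_ac mult_ac)
qed

subsection \<open>The operator of a form\<close>

text \<open>For linear \<open>A\<close> and \<open>F\<close> a finite part of the basis, this is
  \<open>A\<close> after the projection onto the span of \<open>F\<close>. Only the values of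
  \<open>A\<close> on \<open>F\<close> enter, so the result is Hilbert-Schmidt for every
  \<open>A\<close>, in particular for \<open>T \<tau>\<close> before that is known to be so.\<close>

definition hs_trunc :: "('a::complex_inner \<Rightarrow> 'a) \<Rightarrow> 'a set \<Rightarrow> 'a \<Rightarrow> 'a" where
  "hs_trunc A F = (\<lambda>x. \<Sum>e\<in>F. rank1 (A e) e x)"

lemma hs_hs_trunc: "hilbert_schmidt (hs_trunc (A :: 'a::chilbert_space \<Rightarrow> 'a) F)"
  unfolding hs_trunc_def by (rule hs_sum) (rule hs_rank1)

lemma hs_trunc_onb:
  assumes "finite F" "F \<subseteq> the_onb" "e \<in> the_onb"
  shows "hs_trunc A F e = (if e \<in> F then A e else (0 :: 'a::chilbert_space))"
proof -
  have "hs_trunc A F e = (\<Sum>f\<in>F. if f = e then A e else 0)"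
    unfolding hs_trunc_def rank1_def
    by (rule sum.cong)
      (use assms in \<open>auto simp: orthonormal_cinner[OF orthonormal_the_onb] scaleC_one scaleC.zero_left\<close>)
  then show ?thesis using assms(1) by simp
qed

lemma hs_norm_trunc:
  fixes A :: "'a::chilbert_space \<Rightarrow> 'a"
  assumes "finite F" "F \<subseteq> the_onb"
  shows "(hs_norm (hs_trunc A F))\<^sup>2 = (\<Sum>e\<in>F. (norm (A e))\<^sup>2)"
proof (rule hs_norm_eqI[OF hs_hs_trunc])
  have "((\<lambda>e. (norm (A e))\<^sup>2) has_sum (\<Sum>e\<in>F. (norm (A e))\<^sup>2)) F"
    by (rule has_sum_finite[OF assms(1)])
  then show "((\<lambda>e. (norm (hs_trunc A F e))\<^sup>2) has_sum (\<Sum>e\<in>F. (norm (A e))\<^sup>2)) the_onb"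
    by (rule has_sum_cong_neutral[THEN iffD1, rotated -1])
      (use assms in \<open>auto simp: hs_trunc_onb\<close>)
qed

lemma hs_norm_diff_trunc:
  fixes A :: "'a::chilbert_space \<Rightarrow> 'a"
  assumes "hilbert_schmidt A" "finite F" "F \<subseteq> the_onb"
  shows "(hs_norm (\<lambda>x. A x - hs_trunc A F x))\<^sup>2 = (hs_norm A)\<^sup>2 - (\<Sum>e\<in>F. (norm (A e))\<^sup>2)"
proof (rule hs_norm_eqI[OF hs_diff[OF assms(1) hs_hs_trunc]])
  have "((\<lambda>e. (norm (A e))\<^sup>2 - (norm (hs_trunc A F e))\<^sup>2)
      has_sum (hs_norm A)\<^sup>2 - (hs_norm (hs_trunc A F))\<^sup>2) the_onb"
    using has_sum_add[OF hs_norm_has_sum[OF assms(1)] has_sum_uminusI[OF hs_norm_has_sum[OF hs_hs_trunc]]]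
    by simp
  then show "((\<lambda>e. (norm (A e - hs_trunc A F e))\<^sup>2)
      has_sum (hs_norm A)\<^sup>2 - (\<Sum>e\<in>F. (norm (A e))\<^sup>2)) the_onb"
    unfolding hs_norm_trunc[OF assms(2,3)]
    by (rule has_sum_cong[THEN iffD1, rotated]) (use assms in \<open>auto simp: hs_trunc_onb\<close>)
qed

text \<open>The operator \<open>T\<close> is read off from rank one operators, \<open>\<langle>y, (T \<tau>) x\<rangle> = \<phi>(|y\<rangle>\<langle>x|, \<tau>)\<close>;
  testing \<open>\<phi>\<close> on truncations of \<open>T \<tau>\<close> itself shows that \<open>T \<tau>\<close> is Hilbert--Schmidt, so that
  completeness of \<open>S\<^sub>2\<close> is not needed.\<close>

lemma form_operator:
  fixes \<phi> :: "('a::chilbert_space \<Rightarrow> 'a) \<Rightarrow> ('a \<Rightarrow> 'a) \<Rightarrow> complex"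
  assumes \<phi>: "cont_sesq_form \<phi>"
  shows "\<exists>T. bounded_op_S2 T \<and>
    (\<forall>\<eta> \<tau>. hilbert_schmidt \<eta> \<longrightarrow> hilbert_schmidt \<tau> \<longrightarrow> hs_inner \<eta> (T \<tau>) = \<phi> \<eta> \<tau>)"
proof -
  obtain K where K: "K \<ge> 0" "\<And>\<eta> \<tau>. hilbert_schmidt \<eta> \<Longrightarrow> hilbert_schmidt \<tau> \<Longrightarrow>
    cmod (\<phi> \<eta> \<tau>) \<le> K * hs_norm \<eta> * hs_norm \<tau>"
    by (rule form_bound[OF \<phi>], rule that)
  have "\<exists>v. \<forall>y. cinner y v = \<phi> (rank1 y x) \<tau>" if \<tau>: "hilbert_schmidt \<tau>" for \<tau> x
  proof -
    \<comment> \<open>Conjugated, because \<open>\<phi>\<close> is antilinear in \<open>y\<close>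
      while Riesz represents linear functionals.\<close>
    have "\<exists>v. \<forall>y. cnj (\<phi> (rank1 y x) \<tau>) = cinner v y"
    proof (rule riesz_representation)
      show "cmod (cnj (\<phi> (rank1 y x) \<tau>)) \<le> norm y * (K * norm x * hs_norm \<tau>)" for y
        using K(2)[OF hs_rank1 \<tau>, of y x] by (simp add: hs_norm_rank1 mult_ac)
    qed (simp_all add: rank1_add_left rank1_scaleC_left form_add_left[OF \<phi>] form_scaleC_left[OF \<phi>]
        hs_rank1 \<tau>)
    then show ?thesis by (metis cinner_commute complex_cnj_cnj)
  qed
  then obtain T where T: "\<And>\<tau> x y. hilbert_schmidt \<tau> \<Longrightarrow> cinner y (T \<tau> x) = \<phi> (rank1 y x) \<tau>"
    by metis
  have bdd: "bounded_op (T \<tau>)" if \<tau>: "hilbert_schmidt \<tau>" for \<tau>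
  proof (rule bounded_opI)
    fix x
    let ?n = "norm (T \<tau> x)"
    have "?n\<^sup>2 = cmod (\<phi> (rank1 (T \<tau> x) x) \<tau>)"
      unfolding T[OF \<tau>, symmetric] cinner_self_norm norm_of_real by simp
    also have "\<dots> \<le> K * hs_norm (rank1 (T \<tau> x) x) * hs_norm \<tau>"
      by (rule K(2)[OF hs_rank1 \<tau>])
    also have "\<dots> = ?n * (K * hs_norm \<tau> * norm x)"
      by (simp add: hs_norm_rank1 mult_ac)
    finally have "?n * ?n \<le> ?n * (K * hs_norm \<tau> * norm x)"
      by (simp add: power2_eq_square)
    then show "?n \<le> K * hs_norm \<tau> * norm x"
      using K(1) hs_norm_nonneg[OF \<tau>] by (cases "T \<tau> x = 0") (auto simp: mult_le_cancel_left)
  next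
    show "T \<tau> (x + y) = T \<tau> x + T \<tau> y" for x y
      by (rule cinner_ext)
        (simp add: T[OF \<tau>] cinner_add_right rank1_add_right form_add_left[OF \<phi>] hs_rank1 \<tau>)
    show "T \<tau> (c *\<^sub>C x) = c *\<^sub>C T \<tau> x" for c x
      by (rule cinner_ext)
        (simp add: T[OF \<tau>] cinner_scaleC_right rank1_scaleC_right form_scaleC_left[OF \<phi>] hs_rank1 \<tau>)
  qed
  have form_trunc: "\<phi> (hs_trunc A F) \<tau> = (\<Sum>e\<in>F. cinner (A e) (T \<tau> e))"
    if \<tau>: "hilbert_schmidt \<tau>" for A F \<tau>
    unfolding hs_trunc_def by (simp add: form_sum_left[OF \<phi> \<tau>] hs_rank1 T[OF \<tau>])
  have fin_bound: "(\<Sum>e\<in>F. (norm (T \<tau> e))\<^sup>2) \<le> (K * hs_norm \<tau>)\<^sup>2"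
    if \<tau>: "hilbert_schmidt \<tau>" and F: "finite F" "F \<subseteq> the_onb" for \<tau> F
  proof -
    let ?n = "hs_norm (hs_trunc (T \<tau>) F)"
    have n: "?n\<^sup>2 = (\<Sum>e\<in>F. (norm (T \<tau> e))\<^sup>2)" by (rule hs_norm_trunc[OF F])
    \<comment> \<open>The test operator is chosen so that \<open>\<phi>\<close> returns its squared
      norm; the bound on \<open>\<phi>\<close> is linear in that norm, and one factor
      cancels.\<close>
    have "\<phi> (hs_trunc (T \<tau>) F) \<tau> = of_real (?n\<^sup>2)"
      unfolding form_trunc[OF \<tau>] n cinner_self_norm by simp
    then have "?n * ?n \<le> ?n * (K * hs_norm \<tau>)"
      using K(2)[OF hs_hs_trunc \<tau>, of "T \<tau>" F] by (simp add: norm_power power2_eq_square mult_ac norm_mult)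
    moreover have "?n \<ge> 0" by (rule hs_norm_nonneg[OF hs_hs_trunc])
    ultimately have "?n \<le> K * hs_norm \<tau>"
      using K(1) hs_norm_nonneg[OF \<tau>] by (cases "?n = 0") (auto simp: mult_le_cancel_left)
    then have "?n\<^sup>2 \<le> (K * hs_norm \<tau>)\<^sup>2"
      using \<open>?n \<ge> 0\<close> by (rule power_mono)
    then show ?thesis by (simp add: n)
  qed
  have hs: "hilbert_schmidt (T \<tau>)" if \<tau>: "hilbert_schmidt \<tau>" for \<tau>
    unfolding hilbert_schmidt_def
    by (intro conjI bdd[OF \<tau>] nonneg_bdd_above_summable_on bdd_aboveI2[where M = "(K * hs_norm \<tau>)\<^sup>2"])
      (auto intro: fin_bound[OF \<tau>])
  have norm: "hs_norm (T \<tau>) \<le> K * hs_norm \<tau>" if \<tau>: "hilbert_schmidt \<tau>" for \<tau>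
  proof (rule power2_le_imp_le)
    show "(hs_norm (T \<tau>))\<^sup>2 \<le> (K * hs_norm \<tau>)\<^sup>2"
      by (rule has_sum_le_finite_sums[OF hs_norm_has_sum[OF hs[OF \<tau>]] fin_bound[OF \<tau>]])
    show "0 \<le> K * hs_norm \<tau>" using K(1) hs_norm_nonneg[OF \<tau>] by simp
  qed
  have "bounded_op_S2 T"
    unfolding bounded_op_S2_def
  proof (intro conjI allI impI exI[of _ K])
    show "T (\<lambda>x. \<sigma> x + \<tau> x) = (\<lambda>x. T \<sigma> x + T \<tau> x)"
      if "hilbert_schmidt \<sigma>" "hilbert_schmidt \<tau>" for \<sigma> \<tau>
      using that
      by (intro ext cinner_ext)
        (simp add: T hs_plus cinner_add_right form_add_right[OF \<phi>] hs_rank1)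
    show "T (\<lambda>x. c *\<^sub>C \<tau> x) = (\<lambda>x. c *\<^sub>C T \<tau> x)" if "hilbert_schmidt \<tau>" for c \<tau>
      using that
      by (intro ext cinner_ext)
        (simp add: T hs_mult cinner_scaleC_right form_scaleC_right[OF \<phi>] hs_rank1)
  qed (use hs norm in auto)
  moreover have "hs_inner \<eta> (T \<tau>) = \<phi> \<eta> \<tau>" if \<eta>: "hilbert_schmidt \<eta>" and \<tau>: "hilbert_schmidt \<tau>" for \<eta> \<tau>
  proof -
    let ?fs = "finite_subsets_at_top (the_onb :: 'a set)"
    \<comment> \<open>One net of truncations has two limits: the series for \<langle>\<eta>, T
      \<tau>\<rangle>, and, by continuity of \<open>\<phi>\<close>, the value
      \<open>\<phi> \<eta> \<tau>\<close>.\<close>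
    have lim: "((\<lambda>F. \<phi> (hs_trunc \<eta> F) \<tau>) \<longlongrightarrow> hs_inner \<eta> (T \<tau>)) ?fs"
      using hs_inner_has_sum[OF \<eta> hs[OF \<tau>]] unfolding has_sum_def form_trunc[OF \<tau>] .
    have "((\<lambda>F. \<phi> \<eta> \<tau> - \<phi> (hs_trunc \<eta> F) \<tau>) \<longlongrightarrow> 0) ?fs"
    proof (rule Lim_null_comparison)
      have "((\<lambda>F. K * sqrt ((hs_norm \<eta>)\<^sup>2 - (\<Sum>e\<in>F. (norm (\<eta> e))\<^sup>2)) * hs_norm \<tau>)
          \<longlongrightarrow> K * sqrt ((hs_norm \<eta>)\<^sup>2 - (hs_norm \<eta>)\<^sup>2) * hs_norm \<tau>) ?fs"
        using hs_norm_has_sum[OF \<eta>] unfolding has_sum_def by (intro tendsto_intros)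
      then show "((\<lambda>F. K * sqrt ((hs_norm \<eta>)\<^sup>2 - (\<Sum>e\<in>F. (norm (\<eta> e))\<^sup>2)) * hs_norm \<tau>) \<longlongrightarrow> 0) ?fs"
        by simp
      show "\<forall>\<^sub>F F in ?fs. norm (\<phi> \<eta> \<tau> - \<phi> (hs_trunc \<eta> F) \<tau>)
          \<le> K * sqrt ((hs_norm \<eta>)\<^sup>2 - (\<Sum>e\<in>F. (norm (\<eta> e))\<^sup>2)) * hs_norm \<tau>"
      proof (rule eventually_finite_subsets_at_top_weakI)
        fix F :: "'a set" assume F: "finite F" "F \<subseteq> the_onb"
        have "hs_norm (\<lambda>x. \<eta> x - hs_trunc \<eta> F x) = sqrt ((hs_norm \<eta>)\<^sup>2 - (\<Sum>e\<in>F. (norm (\<eta> e))\<^sup>2))"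
          using hs_norm_diff_trunc[OF \<eta> F] hs_norm_nonneg[OF hs_diff[OF \<eta> hs_hs_trunc]]
          by (metis real_sqrt_unique)
        then show "norm (\<phi> \<eta> \<tau> - \<phi> (hs_trunc \<eta> F) \<tau>)
            \<le> K * sqrt ((hs_norm \<eta>)\<^sup>2 - (\<Sum>e\<in>F. (norm (\<eta> e))\<^sup>2)) * hs_norm \<tau>"
          using K(2)[OF hs_diff[OF \<eta> hs_hs_trunc[of \<eta> F]] \<tau>]
          by (simp add: form_diff_left[OF \<phi> \<eta> hs_hs_trunc \<tau>])
      qed
    qed
    then have "((\<lambda>F. \<phi> (hs_trunc \<eta> F) \<tau>) \<longlongrightarrow> \<phi> \<eta> \<tau>) ?fs"
      using tendsto_diff[OF tendsto_const[of "\<phi> \<eta> \<tau>"]] by fastforce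
    then show ?thesis
      by (rule tendsto_unique[OF finite_subsets_at_top_neq_bot lim])
  qed
  ultimately show ?thesis by blast
qed

section \<open>Rearranging series\<close>

text \<open>\<open>prod_decode\<close> runs along the antidiagonals \<open>m + k = N\<close>, with
  \<open>m\<close> rising from 0 to \<open>N\<close>, and antidiagonal \<open>N\<close> starts at
  position \<open>triangle N\<close>. A partial sum thus consists of complete rows and an initial
  segment of one more row; \<open>h\<close> makes the segment negligible without any absolute
  convergence.\<close>

lemma sums_triangular:
  fixes g :: "nat \<Rightarrow> nat \<Rightarrow> 'b::real_normed_vector"
  assumes sums: "(\<lambda>N. \<Sum>m\<le>N. g N m) sums s"
    and bound: "\<And>N M. M \<le> N \<Longrightarrow> norm (\<Sum>m<M. g N m) \<le> h N" and h: "h \<longlonglongrightarrow> 0"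
  shows "(\<lambda>q. case prod_decode q of (m, k) \<Rightarrow> g (m + k) m) sums s"
proof -
  define t where "t q = (case prod_decode q of (m, k) \<Rightarrow> g (m + k) m)" for q
  have t: "t (triangle N + m) = g N m" if "m \<le> N" for N m
  proof -
    have "prod_decode (triangle N + m) = (m, N - m)"
      using that prod_encode_inverse[of "(m, N - m)"] by (simp add: prod_encode_def)
    then show ?thesis using that by (simp add: t_def)
  qed
  \<comment> \<open>The case \<open>M = Suc N\<close> is the complete row, which ends where the next
    antidiagonal starts.\<close>
  have block: "sum t {..<triangle N + M} = sum t {..<triangle N} + (\<Sum>m<M. g N m)"
    if "M \<le> Suc N" for N M
    using that by (induction M) (simp_all add: t add.assoc)
  have tri: "sum t {..<triangle N} = (\<Sum>n<N. \<Sum>m\<le>n. g n m)" for N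
  proof (induction N)
    case (Suc N)
    have "(\<Sum>n<Suc N. \<Sum>m\<le>n. g n m) = (\<Sum>n<N. \<Sum>m\<le>n. g n m) + (\<Sum>m<Suc N. g N m)"
      unfolding sum.lessThan_Suc lessThan_Suc_atMost[symmetric] by simp
    then show ?case
      using block[of "Suc N" N] Suc by (simp only: triangle_Suc order_refl)
  qed simp
  \<comment> \<open>\<open>L q\<close> is the antidiagonal that contains position \<open>q\<close>,
    and \<open>R q\<close> the number of its entries before \<open>q\<close>.\<close>
  define L R where "L q = fst (prod_decode q) + snd (prod_decode q)" and "R q = fst (prod_decode q)" for q
  have q: "q = triangle (L q) + R q" for q
    using prod_decode_inverse[of q] by (simp add: prod_encode_def L_def R_def case_prod_unfold)
  have RL: "R q \<le> L q" for q by (simp add: L_def R_def)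
  have L: "filterlim L at_top sequentially"
    unfolding filterlim_at_top
  proof
    fix Z
    have "{q. \<not> Z \<le> L q} \<subseteq> prod_encode ` ({..Z} \<times> {..Z})"
    proof
      fix q assume "q \<in> {q. \<not> Z \<le> L q}"
      then have "prod_decode q \<in> {..Z} \<times> {..Z}" by (auto simp: L_def mem_Times_iff)
      then show "q \<in> prod_encode ` ({..Z} \<times> {..Z})"
        by (metis image_eqI prod_decode_inverse)
    qed
    then have "finite {q. \<not> Z \<le> L q}" by (rule finite_subset) auto
    then show "\<forall>\<^sub>F q in sequentially. Z \<le> L q"
      by (simp add: cofinite_eq_sequentially[symmetric] eventually_cofinite)
  qed
  have "(\<lambda>q. \<Sum>n<L q. \<Sum>m\<le>n. g n m) \<longlonglongrightarrow> s"
    using sums unfolding sums_def by (rule filterlim_compose[OF _ L])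
  moreover have "(\<lambda>q. \<Sum>m<R q. g (L q) m) \<longlonglongrightarrow> 0"
    by (rule Lim_null_comparison[OF always_eventually filterlim_compose[OF h L]])
      (simp add: bound[OF RL])
  ultimately have "(\<lambda>q. (\<Sum>n<L q. \<Sum>m\<le>n. g n m) + (\<Sum>m<R q. g (L q) m)) \<longlonglongrightarrow> s + 0"
    by (rule tendsto_add)
  moreover have "sum t {..<q} = (\<Sum>n<L q. \<Sum>m\<le>n. g n m) + (\<Sum>m<R q. g (L q) m)" for q
  proof -
    have "sum t {..<q} = sum t {..<triangle (L q) + R q}"
      by (rule arg_cong[where f = "\<lambda>n. sum t {..<n}"], rule q)
    also have "\<dots> = (\<Sum>n<L q. \<Sum>m\<le>n. g n m) + (\<Sum>m<R q. g (L q) m)"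
      using block[of "R q" "L q"] RL[of q] tri[of "L q"] by simp
    finally show ?thesis .
  qed
  ultimately show ?thesis
    unfolding sums_def t_def[symmetric] by simp
qed

text \<open>Pairs control only the partial sums of even length. One of odd length exceeds the
  preceding one by a single term \<open>f (2 * q)\<close>, and this is what \<open>null\<close>
  disposes of.\<close>

lemma sums_pairs:
  fixes f :: "nat \<Rightarrow> 'b::real_normed_vector"
  assumes sums: "(\<lambda>q. f (2 * q) + f (Suc (2 * q))) sums s" and null: "(\<lambda>q. f (2 * q)) \<longlonglongrightarrow> 0"
  shows "f sums s"
proof -
  define r where "r n = (if odd n then f (2 * (n div 2)) else 0)" for n
  have half: "filterlim (\<lambda>n::nat. n div 2) at_top sequentially"
    unfolding filterlim_at_top
  proof
    fix Z :: nat
    show "\<forall>\<^sub>F n in sequentially. Z \<le> n div 2"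
      using eventually_ge_at_top[of "2 * Z"] by eventually_elim simp
  qed
  have split: "sum f {..<n} = (\<Sum>q<n div 2. f (2 * q) + f (Suc (2 * q))) + r n" for n
  proof -
    have even: "sum f {..<2 * k} = (\<Sum>q<k. f (2 * q) + f (Suc (2 * q)))" for k
      by (induction k) (simp_all add: add.assoc)
    show ?thesis
    proof (cases "even n")
      case True
      then show ?thesis using even[of "n div 2"] by (simp add: r_def)
    next
      case False
      then have "n = Suc (2 * (n div 2))" by presburger
      then have "sum f {..<n} = sum f {..<Suc (2 * (n div 2))}"
        by (rule arg_cong)
      also have "\<dots> = sum f {..<2 * (n div 2)} + f (2 * (n div 2))"
        by (rule sum.lessThan_Suc)
      also have "f (2 * (n div 2)) = r n"
        unfolding r_def by (rule if_P[OF False, symmetric])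
      finally show ?thesis unfolding even .
    qed
  qed
  have "r \<longlonglongrightarrow> 0"
    by (rule Lim_null_comparison[OF always_eventually
          tendsto_norm_zero[OF filterlim_compose[OF null half]]]) (simp add: r_def)
  moreover have "(\<lambda>n. \<Sum>q<n div 2. f (2 * q) + f (Suc (2 * q))) \<longlonglongrightarrow> s"
    using sums unfolding sums_def by (rule filterlim_compose[OF _ half])
  ultimately show ?thesis
    unfolding sums_def split using tendsto_add by fastforce
qed

lemma injective_family_tendsto_zero:
  fixes F :: "'i \<Rightarrow> real"
  assumes "F summable_on X" "inj_on h J" "h ` J \<subseteq> X"
    and "\<And>q. q \<in> J \<Longrightarrow> r q = F (h q)" "\<And>q. q \<notin> J \<Longrightarrow> r q = 0"
  shows "r \<longlonglongrightarrow> (0::real)"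
proof -
  have "F summable_on h ` J"
    by (rule summable_on_subset_banach[OF assms(1,3)])
  then have "(F \<circ> h) summable_on J"
    by (rule summable_on_reindex[OF assms(2), THEN iffD1])
  then have "r summable_on UNIV"
    by (rule summable_on_cong_neutral[THEN iffD1, rotated -1]) (use assms in auto)
  then show ?thesis
    by (intro summable_LIMSEQ_zero summable_on_imp_summable)
qed

lemma summable_on_product:
  fixes a :: "'i \<Rightarrow> real" and b :: "'j \<Rightarrow> real"
  assumes "a summable_on X" "b summable_on Y" "\<And>x. a x \<ge> 0" "\<And>y. b y \<ge> 0"
  shows "(\<lambda>(x, y). a x * b y) summable_on X \<times> Y"
proof (rule summable_on_SigmaI)
  show "((\<lambda>y. case (x, y) of (x, y) \<Rightarrow> a x * b y) has_sum a x * infsum b Y) Y" for x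
    using has_sum_cmult_right[OF has_sum_infsum[OF assms(2)], of "a x"] by simp
  show "(\<lambda>x. a x * infsum b Y) summable_on X"
    by (rule summable_on_cmult_left[OF assms(1)])
qed (use assms in simp)

text \<open>A single factor need not tend to zero, since its index may stay fixed while
  \<open>q\<close> grows. The squared products, however, are summable over all quadruples of basis
  vectors, and an injective selection from a summable family tends to zero. Outside \<open>Q\<close>
  the padding makes one factor vanish.\<close>

lemma coeff_product_tendsto_zero:
  fixes \<eta> \<tau> :: "'a::chilbert_space \<Rightarrow> 'a"
  assumes \<eta>: "hilbert_schmidt \<eta>" and \<tau>: "hilbert_schmidt \<tau>"
    and sub: "\<And>q. q \<in> Q \<Longrightarrow> a q \<in> the_onb \<and> b q \<in> the_onb \<and> c q \<in> the_onb \<and> d q \<in> the_onb"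
    and zero: "\<And>q. q \<notin> Q \<Longrightarrow> a q = 0 \<or> c q = 0"
    and inj: "inj_on (\<lambda>q. ((a q, b q), (c q, d q))) Q"
  shows "(\<lambda>q. cmod (cinner (a q) (\<eta> (b q))) * cmod (cinner (c q) (\<tau> (d q)))) \<longlonglongrightarrow> 0"
proof -
  let ?C = "\<lambda>\<sigma>. \<lambda>(e, f). (cmod (cinner e (\<sigma> f)))\<^sup>2"
  let ?r = "\<lambda>q. cmod (cinner (a q) (\<eta> (b q))) * cmod (cinner (c q) (\<tau> (d q)))"
  have C: "?C \<sigma> summable_on (the_onb \<times> the_onb)" if "hilbert_schmidt \<sigma>" for \<sigma> :: "'a \<Rightarrow> 'a"
    by (rule has_sum_imp_summable[OF hs_coeff_norm[OF that]])
  have "(\<lambda>q. (?r q)\<^sup>2) \<longlonglongrightarrow> 0"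
  proof (rule injective_family_tendsto_zero[OF summable_on_product[OF C[OF \<eta>] C[OF \<tau>]] inj])
    show "(\<lambda>q. ((a q, b q), (c q, d q))) ` Q \<subseteq> (the_onb \<times> the_onb) \<times> (the_onb \<times> the_onb)"
      using sub by auto
    show "(?r q)\<^sup>2 = 0" if "q \<notin> Q" for q
      using zero[OF that] by (auto simp: cinner.zero_left)
  qed (auto simp: power_mult_distrib)
  then have "(\<lambda>q. sqrt ((?r q)\<^sup>2)) \<longlonglongrightarrow> sqrt 0" by (rule tendsto_real_sqrt)
  then show ?thesis by simp
qed

section \<open>Self-adjoint operators of rank two\<close>

text \<open>With \<open>a = rank1 u v\<close> this is \<open>a + adj a\<close>. A scalar on
  \<open>u\<close> multiplies \<open>a\<close>, so the factor \<open>- \<i>\<close> yields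
  \<open>- \<i>\<close> times \<open>a - adj a\<close>: real and imaginary parts share this one
  shape.\<close>

definition rank2 :: "'a::complex_inner \<Rightarrow> 'a \<Rightarrow> 'a \<Rightarrow> 'a" where
  "rank2 u v = (\<lambda>x. rank1 u v x + rank1 v u x)"

lemma selfadjoint_rank2: "selfadjoint_op (rank2 u v)"
  unfolding selfadjoint_op_def
proof (intro conjI allI)
  show "bounded_op (rank2 u v)"
    unfolding rank2_def by (intro bounded_op_plus bounded_op_rank1)
  have *: "cnj (cinner v x) = cinner x v" for v x :: 'a by (metis cinner_commute)
  show "cinner (rank2 u v x) y = cinner x (rank2 u v y)" for x y
    by (simp add: rank2_def rank1_def cinner_add_left cinner_add_right cinner_scaleC_left
        cinner_scaleC_right * mult.commute)
qed

lemma hs_inner_rank2_sandwich: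
  fixes \<eta> \<tau> :: "'a::chilbert_space \<Rightarrow> 'a"
  assumes \<eta>: "hilbert_schmidt \<eta>" and \<tau>: "hilbert_schmidt \<tau>"
  shows "hs_inner \<eta> (\<lambda>x. rank2 u v (\<tau> (rank2 w z x)))
    = cinner (\<eta> z) u * cinner v (\<tau> w) + cinner (\<eta> z) v * cinner u (\<tau> w)
    + cinner (\<eta> w) u * cinner v (\<tau> z) + cinner (\<eta> w) v * cinner u (\<tau> z)"
proof -
  note t = bounded_op_add[OF hs_bounded[OF \<tau>]] bounded_op_scaleC[OF hs_bounded[OF \<tau>]]
  have "(\<lambda>x. rank2 u v (\<tau> (rank2 w z x)))
      = (\<lambda>x. rank1 (cinner v (\<tau> w) *\<^sub>C u + cinner u (\<tau> w) *\<^sub>C v) z x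
           + rank1 (cinner v (\<tau> z) *\<^sub>C u + cinner u (\<tau> z) *\<^sub>C v) w x)"
    by (simp add: rank2_def rank1_def t cinner_add_right cinner_scaleC_right scaleC_add_right
        scaleC_add_left scaleC_scaleC add_ac)
  then have "hs_inner \<eta> (\<lambda>x. rank2 u v (\<tau> (rank2 w z x)))
      = cinner (\<eta> z) (cinner v (\<tau> w) *\<^sub>C u + cinner u (\<tau> w) *\<^sub>C v)
      + cinner (\<eta> w) (cinner v (\<tau> z) *\<^sub>C u + cinner u (\<tau> z) *\<^sub>C v)"
    by (simp add: hs_inner_add_right[OF \<eta> hs_rank1 hs_rank1] hs_inner_rank1[OF \<eta>])
  then show ?thesis
    by (simp add: cinner_add_right cinner_scaleC_right mult.commute)
qed

text \<open>The scalars decide which products survive: adding the cases \<open>s = t\<close>,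
  \<open>r = 1/2\<close> and \<open>s = - \<i> * t\<close>, \<open>r = \<i>/2\<close> cancels the
  two middle products and leaves the outer ones with coefficients \<open>t\<close> and
  \<open>cnj t\<close>.\<close>

lemma hs_inner_rank2_sandwich_scaleC:
  fixes \<eta> \<tau> :: "'a::chilbert_space \<Rightarrow> 'a"
  assumes \<eta>: "hilbert_schmidt \<eta>" and \<tau>: "hilbert_schmidt \<tau>"
  shows "hs_inner \<eta> (\<lambda>x. rank2 (s *\<^sub>C u) v (\<tau> (rank2 (r *\<^sub>C w) z x)))
    = s * r * (cinner (\<eta> z) u * cinner v (\<tau> w)) + cnj s * r * (cinner (\<eta> z) v * cinner u (\<tau> w))
    + s * cnj r * (cinner (\<eta> w) u * cinner v (\<tau> z))
    + cnj s * cnj r * (cinner (\<eta> w) v * cinner u (\<tau> z))"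
  by (simp add: hs_inner_rank2_sandwich[OF \<eta> \<tau>] cinner_scaleC_left cinner_scaleC_right
      bounded_op_scaleC[OF hs_bounded[OF \<eta>]] bounded_op_scaleC[OF hs_bounded[OF \<tau>]] mult_ac)

section \<open>Matrix coefficients\<close>

text \<open>The index set \<open>J\<close> allows for finite-dimensional spaces: the enumeration of the matrix units
  is padded with zeros outside of \<open>J\<close>.\<close>

locale hs_enum =
  fixes e f :: "nat \<Rightarrow> 'a::chilbert_space" and J :: "nat set"
  assumes bij: "bij_betw (\<lambda>n. (e n, f n)) J (the_onb \<times> the_onb)"
    and zero: "n \<notin> J \<Longrightarrow> e n = 0" "n \<notin> J \<Longrightarrow> f n = 0"
begin

definition E :: "nat \<Rightarrow> 'a \<Rightarrow> 'a" where "E n = rank1 (e n) (f n)"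

text \<open>For Hilbert-Schmidt \<open>\<eta>\<close> this is \<open>hs_inner (E n) \<eta>\<close>,
  the coordinate of \<open>\<eta>\<close> along the matrix unit \<open>E n\<close>.\<close>

definition coeff :: "('a \<Rightarrow> 'a) \<Rightarrow> nat \<Rightarrow> complex" where "coeff \<eta> n = cinner (e n) (\<eta> (f n))"

definition partial :: "nat \<Rightarrow> ('a \<Rightarrow> 'a) \<Rightarrow> 'a \<Rightarrow> 'a" where
  "partial N \<eta> = (\<lambda>x. \<Sum>n<N. coeff \<eta> n *\<^sub>C E n x)"

lemma in_onb: "n \<in> J \<Longrightarrow> e n \<in> the_onb" "n \<in> J \<Longrightarrow> f n \<in> the_onb"
  using bij by (auto simp: bij_betw_def)

lemma inj: "m \<in> J \<Longrightarrow> n \<in> J \<Longrightarrow> e m = e n \<Longrightarrow> f m = f n \<Longrightarrow> m = n"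
  using bij by (auto simp: bij_betw_def inj_on_def)

lemma hs_E: "hilbert_schmidt (E n)"
  by (simp add: E_def hs_rank1)

lemma hs_norm_E: "hs_norm (E n) \<le> 1"
proof -
  have "norm (e n) \<le> 1" "norm (f n) \<le> 1"
    using in_onb[of n] zero[of n] orthonormal_the_onb[where 'a = 'a]
    by (cases "n \<in> J"; simp add: orthonormal_def)+
  then show ?thesis by (simp add: E_def hs_norm_rank1 mult_le_one)
qed

lemma hs_partial: "hilbert_schmidt (partial N \<eta>)"
  unfolding partial_def by (intro hs_sum hs_mult hs_E)

lemma coeff_zero: "n \<notin> J \<Longrightarrow> coeff \<eta> n = 0"
  by (simp add: coeff_def zero cinner.zero_left)

lemma coeff_E: "coeff (E n) m = (if m = n \<and> n \<in> J then 1 else 0)"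
proof (cases "m \<in> J \<and> n \<in> J")
  case True
  then show ?thesis
    using in_onb[of m] in_onb[of n] inj[of m n]
    by (auto simp: coeff_def E_def rank1_def cinner_scaleC_right orthonormal_cinner[OF orthonormal_the_onb])
next
  case False
  then show ?thesis
    by (auto simp: coeff_def E_def rank1_def cinner_scaleC_right zero cinner.zero_left cinner.zero_right)
qed

lemma coeff_diff: "coeff (\<lambda>x. \<eta> x - \<tau> x) m = coeff \<eta> m - coeff \<tau> m"
  by (simp add: coeff_def cinner.diff_right)

lemma coeff_partial: "coeff (partial N \<eta>) m = (if m < N then coeff \<eta> m else 0)"
proof -
  have "coeff (partial N \<eta>) m = (\<Sum>n<N. coeff \<eta> n * coeff (E n) m)"
    by (simp add: coeff_def partial_def cinner.sum_right cinner_scaleC_right)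
  also have "\<dots> = (\<Sum>n<N. if n = m then coeff \<eta> m else 0)"
    by (rule sum.cong) (auto simp: coeff_E coeff_zero)
  finally show ?thesis by simp
qed

lemma coeff_has_sum:
  assumes "hilbert_schmidt \<eta>"
  shows "((\<lambda>n. (cmod (coeff \<eta> n))\<^sup>2) has_sum (hs_norm \<eta>)\<^sup>2) UNIV"
proof -
  have "((\<lambda>n. (cmod (coeff \<eta> n))\<^sup>2) has_sum (hs_norm \<eta>)\<^sup>2) J"
    using has_sum_reindex_bij_betw[OF bij, THEN iffD2, OF hs_coeff_norm[OF assms]]
    by (simp add: coeff_def)
  then show ?thesis
    by (rule has_sum_cong_neutral[THEN iffD1, rotated -1]) (auto simp: coeff_zero)
qed

lemma coeff_sums:
  assumes "hilbert_schmidt \<eta>"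
  shows "(\<lambda>n. (cmod (coeff \<eta> n))\<^sup>2) sums (hs_norm \<eta>)\<^sup>2"
  by (rule has_sum_imp_sums[OF coeff_has_sum[OF assms]])

lemma coeff_tendsto_zero:
  assumes "hilbert_schmidt \<eta>"
  shows "(\<lambda>n. cmod (coeff \<eta> n)) \<longlonglongrightarrow> 0"
proof -
  have "(\<lambda>n. sqrt ((cmod (coeff \<eta> n))\<^sup>2)) \<longlonglongrightarrow> sqrt 0"
    by (intro tendsto_real_sqrt summable_LIMSEQ_zero sums_summable[OF coeff_sums[OF assms]])
  then show ?thesis by simp
qed

lemma hs_norm_partial:
  assumes "hilbert_schmidt \<eta>"
  shows "hs_norm (partial N \<eta>) \<le> hs_norm \<eta>"
proof (rule power2_le_imp_le[OF _ hs_norm_nonneg[OF assms]])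
  show "(hs_norm (partial N \<eta>))\<^sup>2 \<le> (hs_norm \<eta>)\<^sup>2"
    by (rule has_sum_mono[OF coeff_has_sum[OF hs_partial] coeff_has_sum[OF assms]])
      (simp add: coeff_partial)
qed

lemma hs_norm_diff_partial:
  assumes "hilbert_schmidt \<eta>"
  shows "(\<lambda>N. hs_norm (\<lambda>x. \<eta> x - partial N \<eta> x)) \<longlonglongrightarrow> 0"
proof -
  have "(hs_norm (\<lambda>x. \<eta> x - partial N \<eta> x))\<^sup>2 = (hs_norm \<eta>)\<^sup>2 - (\<Sum>n<N. (cmod (coeff \<eta> n))\<^sup>2)" for N
  proof (rule sums_unique2)
    show "(\<lambda>n. (cmod (coeff (\<lambda>x. \<eta> x - partial N \<eta> x) n))\<^sup>2)
        sums (hs_norm (\<lambda>x. \<eta> x - partial N \<eta> x))\<^sup>2"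
      by (rule coeff_sums[OF hs_diff[OF assms hs_partial]])
    have "(\<lambda>n. (cmod (coeff \<eta> n))\<^sup>2 - (if n \<in> {..<N} then (cmod (coeff \<eta> n))\<^sup>2 else 0))
        sums ((hs_norm \<eta>)\<^sup>2 - (\<Sum>n<N. (cmod (coeff \<eta> n))\<^sup>2))"
      by (intro sums_diff coeff_sums[OF assms] sums_If_finite_set) simp
    then show "(\<lambda>n. (cmod (coeff (\<lambda>x. \<eta> x - partial N \<eta> x) n))\<^sup>2)
        sums ((hs_norm \<eta>)\<^sup>2 - (\<Sum>n<N. (cmod (coeff \<eta> n))\<^sup>2))"
      by (rule sums_cong[THEN iffD1, rotated]) (simp add: coeff_diff coeff_partial)
  qed
  then have "hs_norm (\<lambda>x. \<eta> x - partial N \<eta> x)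
      = sqrt ((hs_norm \<eta>)\<^sup>2 - (\<Sum>n<N. (cmod (coeff \<eta> n))\<^sup>2))" for N
    using hs_norm_nonneg[OF hs_diff[OF assms hs_partial]] by (metis real_sqrt_unique)
  moreover have "(\<lambda>N. sqrt ((hs_norm \<eta>)\<^sup>2 - (\<Sum>n<N. (cmod (coeff \<eta> n))\<^sup>2)))
      \<longlonglongrightarrow> sqrt ((hs_norm \<eta>)\<^sup>2 - (hs_norm \<eta>)\<^sup>2)"
    using coeff_sums[OF assms] unfolding sums_def by (intro tendsto_intros)
  ultimately show ?thesis by simp
qed

text \<open>Truncating one argument at a time splits the error into a form value on the remainder of
  \<open>\<eta>\<close> and one on the remainder of \<open>\<tau>\<close>; truncation does not
  increase the norm of the other argument.\<close>

lemma form_partial_tendsto: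
  assumes \<phi>: "cont_sesq_form \<phi>" and \<eta>: "hilbert_schmidt \<eta>" and \<tau>: "hilbert_schmidt \<tau>"
  shows "(\<lambda>N. \<phi> (partial N \<eta>) (partial N \<tau>)) \<longlonglongrightarrow> \<phi> \<eta> \<tau>"
proof -
  obtain K where K: "K \<ge> 0" "\<And>\<eta> \<tau>. hilbert_schmidt \<eta> \<Longrightarrow> hilbert_schmidt \<tau> \<Longrightarrow>
    cmod (\<phi> \<eta> \<tau>) \<le> K * hs_norm \<eta> * hs_norm \<tau>"
    by (rule form_bound[OF \<phi>], rule that)
  let ?d = "\<lambda>\<eta> N. hs_norm (\<lambda>x. \<eta> x - partial N \<eta> x)"
  have "(\<lambda>N. \<phi> \<eta> \<tau> - \<phi> (partial N \<eta>) (partial N \<tau>)) \<longlonglongrightarrow> 0"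
  proof (rule Lim_null_comparison[OF always_eventually], rule allI)
    fix N
    have "cmod (\<phi> \<eta> \<tau> - \<phi> (partial N \<eta>) (partial N \<tau>))
        = cmod (\<phi> (\<lambda>x. \<eta> x - partial N \<eta> x) \<tau> + \<phi> (partial N \<eta>) (\<lambda>x. \<tau> x - partial N \<tau> x))"
      by (simp add: form_diff_left[OF \<phi>] form_diff_right[OF \<phi>] \<eta> \<tau> hs_partial)
    also have "\<dots> \<le> K * ?d \<eta> N * hs_norm \<tau> + K * hs_norm (partial N \<eta>) * ?d \<tau> N"
      by (intro norm_triangle_le add_mono K(2) hs_diff hs_partial \<eta> \<tau>)
    also have "\<dots> \<le> K * ?d \<eta> N * hs_norm \<tau> + K * hs_norm \<eta> * ?d \<tau> N"
      by (intro add_left_mono mult_right_mono mult_left_mono hs_norm_partial K(1) hs_norm_nonneg hs_diff hs_partial \<eta> \<tau>)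
    finally show "norm (\<phi> \<eta> \<tau> - \<phi> (partial N \<eta>) (partial N \<tau>))
        \<le> K * ?d \<eta> N * hs_norm \<tau> + K * hs_norm \<eta> * ?d \<tau> N" by simp
  next
    have "(\<lambda>N. K * ?d \<eta> N * hs_norm \<tau> + K * hs_norm \<eta> * ?d \<tau> N)
        \<longlonglongrightarrow> K * 0 * hs_norm \<tau> + K * hs_norm \<eta> * 0"
      by (intro tendsto_intros hs_norm_diff_partial \<eta> \<tau>)
    then show "(\<lambda>N. K * ?d \<eta> N * hs_norm \<tau> + K * hs_norm \<eta> * ?d \<tau> N) \<longlonglongrightarrow> 0" by simp
  qed
  from tendsto_diff[OF tendsto_const[of "\<phi> \<eta> \<tau>"] this] show ?thesis by simp
qed

lemma form_partial_left:
  assumes "cont_sesq_form \<phi>" "hilbert_schmidt \<tau>"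
  shows "\<phi> (partial N \<eta>) \<tau> = (\<Sum>n<N. cnj (coeff \<eta> n) * \<phi> (E n) \<tau>)"
  unfolding partial_def
  by (simp add: form_sum_left[OF assms] form_scaleC_left[OF assms(1) hs_E assms(2)] hs_mult hs_E)

lemma form_partial_right:
  assumes "cont_sesq_form \<phi>" "hilbert_schmidt \<eta>"
  shows "\<phi> \<eta> (partial N \<tau>) = (\<Sum>n<N. coeff \<tau> n * \<phi> \<eta> (E n))"
  unfolding partial_def
  by (simp add: form_sum_right[OF assms] form_scaleC_right[OF assms hs_E] hs_mult hs_E)

text \<open>The diagonal entries are halved because \<open>pair\<close> below counts them twice.\<close>

definition entry :: "(('a \<Rightarrow> 'a) \<Rightarrow> ('a \<Rightarrow> 'a) \<Rightarrow> complex) \<Rightarrow> nat \<Rightarrow> nat \<Rightarrow> complex" where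
  "entry \<phi> N m = (if m = N then 1/2 else 1) * \<phi> (E m) (E N)"

text \<open>The entry at \<open>(m, N)\<close> of the matrix of \<open>\<phi>\<close> together with
  its mirror image at \<open>(N, m)\<close>, which for hermitian \<open>\<phi>\<close> is the
  conjugate.\<close>

definition pair :: "(('a \<Rightarrow> 'a) \<Rightarrow> ('a \<Rightarrow> 'a) \<Rightarrow> complex) \<Rightarrow> ('a \<Rightarrow> 'a) \<Rightarrow> ('a \<Rightarrow> 'a) \<Rightarrow> nat \<Rightarrow> nat \<Rightarrow> complex" where
  "pair \<phi> \<eta> \<tau> N m = entry \<phi> N m * cnj (coeff \<eta> m) * coeff \<tau> N
     + cnj (entry \<phi> N m) * cnj (coeff \<eta> N) * coeff \<tau> m"

section \<open>Summing the matrix of a hermitian form along growing squares\<close>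

context
  fixes \<phi> :: "('a \<Rightarrow> 'a) \<Rightarrow> ('a \<Rightarrow> 'a) \<Rightarrow> complex"
  assumes form: "cont_sesq_form \<phi>"
    and hermitian: "\<And>\<eta> \<tau>. hilbert_schmidt \<eta> \<Longrightarrow> hilbert_schmidt \<tau> \<Longrightarrow> cnj (\<phi> \<eta> \<tau>) = \<phi> \<tau> \<eta>"
begin

text \<open>For \<open>m < N\<close> no halved entry occurs, and the sum over \<open>m\<close> moves
  into the arguments of \<open>\<phi>\<close>. This closed form is what gives a bound uniform in
  \<open>M\<close>.\<close>

lemma pair_sum_less:
  assumes "M \<le> N"
  shows "(\<Sum>m<M. pair \<phi> \<eta> \<tau> N m)
    = \<phi> (partial M \<eta>) (E N) * coeff \<tau> N + cnj (coeff \<eta> N) * \<phi> (E N) (partial M \<tau>)"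
proof -
  have "(\<Sum>m<M. pair \<phi> \<eta> \<tau> N m)
      = (\<Sum>m<M. cnj (coeff \<eta> m) * \<phi> (E m) (E N) * coeff \<tau> N
          + cnj (coeff \<eta> N) * (coeff \<tau> m * \<phi> (E N) (E m)))"
    by (rule sum.cong) (use assms in \<open>auto simp: pair_def entry_def hermitian hs_E mult_ac\<close>)
  then show ?thesis
    by (simp add: form_partial_left[OF form hs_E] form_partial_right[OF form hs_E]
        sum.distrib sum_distrib_left sum_distrib_right)
qed

text \<open>The pairs with \<open>m \<le> N\<close> fill exactly the row and the column by which the
  square of side \<open>Suc N\<close> exceeds the square of side \<open>N\<close>.\<close>

lemma pair_sum_block:
  "(\<Sum>m\<le>N. pair \<phi> \<eta> \<tau> N m)
    = \<phi> (partial (Suc N) \<eta>) (partial (Suc N) \<tau>) - \<phi> (partial N \<eta>) (partial N \<tau>)"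
proof -
  \<comment> \<open>A hermitian form is real on the diagonal, so the two halves of the diagonal
    entry add up to it.\<close>
  have "cnj (\<phi> (E N) (E N)) = \<phi> (E N) (E N)" by (rule hermitian[OF hs_E hs_E])
  then have diag: "pair \<phi> \<eta> \<tau> N N = cnj (coeff \<eta> N) * coeff \<tau> N * \<phi> (E N) (E N)"
    by (simp add: pair_def entry_def)
  have Suc: "partial (Suc N) \<sigma> = (\<lambda>x. partial N \<sigma> x + coeff \<sigma> N *\<^sub>C E N x)" for \<sigma>
    by (simp add: partial_def)
  have "\<phi> (partial (Suc N) \<eta>) (partial (Suc N) \<tau>)
      = \<phi> (partial N \<eta>) (partial N \<tau>) + coeff \<tau> N * \<phi> (partial N \<eta>) (E N)
      + (cnj (coeff \<eta> N) * \<phi> (E N) (partial N \<tau>) + cnj (coeff \<eta> N) * (coeff \<tau> N * \<phi> (E N) (E N)))"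
    unfolding Suc
    by (simp add: form_add_left[OF form] form_add_right[OF form] form_scaleC_left[OF form]
        form_scaleC_right[OF form] hs_plus hs_mult hs_E hs_partial distrib_left)
  then show ?thesis
    by (simp add: lessThan_Suc_atMost[symmetric] pair_sum_less diag)
qed

text \<open>The sum over borders telescopes to the limit of the truncated forms. Within a border,
  continuity bounds each partial sum by multiples of the coefficients of \<open>\<eta>\<close> and
  \<open>\<tau>\<close> at the single index \<open>N\<close>, and these tend to zero.\<close>

lemma pair_sums:
  assumes \<eta>: "hilbert_schmidt \<eta>" and \<tau>: "hilbert_schmidt \<tau>"
  shows "(\<lambda>q. case prod_decode q of (m, k) \<Rightarrow> pair \<phi> \<eta> \<tau> (m + k) m) sums \<phi> \<eta> \<tau>"
proof -
  obtain K where K: "K \<ge> 0" "\<And>\<eta> \<tau>. hilbert_schmidt \<eta> \<Longrightarrow> hilbert_schmidt \<tau> \<Longrightarrow>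
    cmod (\<phi> \<eta> \<tau>) \<le> K * hs_norm \<eta> * hs_norm \<tau>"
    by (rule form_bound[OF form], rule that)
  have left: "cmod (\<phi> (partial M \<eta>) (E N)) \<le> K * hs_norm \<eta>" for M N
  proof -
    have "cmod (\<phi> (partial M \<eta>) (E N)) \<le> K * hs_norm (partial M \<eta>) * hs_norm (E N)"
      by (rule K(2)[OF hs_partial hs_E])
    also have "\<dots> \<le> K * hs_norm \<eta> * 1"
      by (intro mult_mono mult_left_mono hs_norm_partial hs_norm_E mult_nonneg_nonneg hs_norm_nonneg hs_E K(1) \<eta>)
    finally show ?thesis by simp
  qed
  have right: "cmod (\<phi> (E N) (partial M \<tau>)) \<le> K * hs_norm \<tau>" for M N
  proof -
    have "cmod (\<phi> (E N) (partial M \<tau>)) \<le> K * hs_norm (E N) * hs_norm (partial M \<tau>)"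
      by (rule K(2)[OF hs_E hs_partial])
    also have "\<dots> \<le> K * 1 * hs_norm \<tau>"
      by (intro mult_mono mult_left_mono hs_norm_partial hs_norm_E mult_nonneg_nonneg hs_norm_nonneg
          hs_partial K(1) \<tau>) (simp add: K(1))
    finally show ?thesis by simp
  qed
  show ?thesis
  proof (rule sums_triangular)
    have "\<phi> (partial 0 \<eta>) (partial 0 \<tau>) = 0"
      by (simp add: form_partial_left[OF form hs_partial])
    then show "(\<lambda>N. \<Sum>m\<le>N. pair \<phi> \<eta> \<tau> N m) sums \<phi> \<eta> \<tau>"
      unfolding pair_sum_block using telescope_sums[OF form_partial_tendsto[OF form \<eta> \<tau>]] by simp
    show "norm (\<Sum>m<M. pair \<phi> \<eta> \<tau> N m)
        \<le> K * hs_norm \<eta> * cmod (coeff \<tau> N) + cmod (coeff \<eta> N) * (K * hs_norm \<tau>)" if "M \<le> N" for N M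
      unfolding pair_sum_less[OF that]
      by (intro norm_triangle_le add_mono)
        (simp_all add: norm_mult mult_right_mono[OF left] mult_left_mono[OF right])
    have "(\<lambda>N. K * hs_norm \<eta> * cmod (coeff \<tau> N) + cmod (coeff \<eta> N) * (K * hs_norm \<tau>))
        \<longlonglongrightarrow> K * hs_norm \<eta> * 0 + 0 * (K * hs_norm \<tau>)"
      by (intro tendsto_intros coeff_tendsto_zero \<eta> \<tau>)
    then show "(\<lambda>N. K * hs_norm \<eta> * cmod (coeff \<tau> N) + cmod (coeff \<eta> N) * (K * hs_norm \<tau>)) \<longlonglongrightarrow> 0"
      by simp
  qed
qed

end

text \<open>With \<open>a = t|e\<^sub>m\<rangle>\<langle>e\<^sub>N|\<close> and \<open>b = |f\<^sub>N\<rangle>\<langle>f\<^sub>m|\<close>, the sequences \<open>A\<close> and \<open>B\<close> below realise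
  \<open>a \<tau> b + a\<^sup>* \<tau> b\<^sup>* = \<onehalf> (a + a\<^sup>*) \<tau> (b + b\<^sup>*) - \<onehalf> (-\<i>)(a - a\<^sup>*) \<tau> (-\<i>)(b - b\<^sup>*)\<close>
  in their entries \<open>2 q\<close> and \<open>2 q + 1\<close>.\<close>

lemma hermitian_selfadjoint_sums:
  fixes \<phi> :: "('a \<Rightarrow> 'a) \<Rightarrow> ('a \<Rightarrow> 'a) \<Rightarrow> complex"
  assumes \<phi>: "cont_sesq_form \<phi>"
    and herm: "\<And>\<eta> \<tau>. hilbert_schmidt \<eta> \<Longrightarrow> hilbert_schmidt \<tau> \<Longrightarrow> cnj (\<phi> \<eta> \<tau>) = \<phi> \<tau> \<eta>"
  shows "\<exists>A B. (\<forall>n. selfadjoint_op (A n) \<and> selfadjoint_op (B n)) \<and>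
    (\<forall>\<eta> \<tau>. hilbert_schmidt \<eta> \<longrightarrow> hilbert_schmidt \<tau> \<longrightarrow>
      (\<lambda>n. hs_inner \<eta> (\<lambda>x. A n (\<tau> (B n x)))) sums \<phi> \<eta> \<tau>)"
proof -
  \<comment> \<open>The \<open>q\<close>-th pair occupies the positions \<open>(mm q, nn q)\<close>
    and \<open>(nn q, mm q)\<close>, where \<open>mm q \<le> nn q\<close>.\<close>
  define mm where "mm q = fst (prod_decode q)" for q
  define nn where "nn q = fst (prod_decode q) + snd (prod_decode q)" for q
  define t where "t q = entry \<phi> (nn q) (mm q)" for q
  define A where "A n = rank2 ((if even n then t (n div 2) else - \<i> * t (n div 2)) *\<^sub>C e (mm (n div 2)))
    (e (nn (n div 2)))" for n
  \<comment> \<open>The factor 1/2 of both terms and the minus sign of the second are absorbed here: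
    in odd entries, minus one half of \<open>- \<i>\<close> is \<open>\<i>/2\<close>.\<close>
  define B where "B n = rank2 ((if even n then 1/2 else \<i>/2) *\<^sub>C f (nn (n div 2))) (f (mm (n div 2)))" for n
  have inj_mn: "q = q'" if "mm q = mm q'" "nn q = nn q'" for q q'
  proof -
    have "prod_decode q = prod_decode q'"
      using that by (simp add: mm_def nn_def prod_eq_iff)
    then show ?thesis by (metis prod_decode_inverse)
  qed
  obtain K where K: "K \<ge> 0" "\<And>\<eta> \<tau>. hilbert_schmidt \<eta> \<Longrightarrow> hilbert_schmidt \<tau> \<Longrightarrow>
    cmod (\<phi> \<eta> \<tau>) \<le> K * hs_norm \<eta> * hs_norm \<tau>"
    by (rule form_bound[OF \<phi>], rule that)
  have tK: "cmod (t q) \<le> K" for q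
  proof -
    have "cmod (\<phi> (E (mm q)) (E (nn q))) \<le> K * hs_norm (E (mm q)) * hs_norm (E (nn q))"
      by (rule K(2)[OF hs_E hs_E])
    also have "\<dots> \<le> K * 1 * 1"
      by (intro mult_mono mult_left_mono hs_norm_E mult_nonneg_nonneg hs_norm_nonneg hs_E K(1)) (simp_all add: K(1))
    finally have "cmod (\<phi> (E (mm q)) (E (nn q))) \<le> K" by simp
    moreover have "cmod (t q) \<le> 1 * cmod (\<phi> (E (mm q)) (E (nn q)))"
      unfolding t_def entry_def norm_mult by (rule mult_right_mono) simp_all
    ultimately show ?thesis by simp
  qed
  have main: "(\<lambda>n. hs_inner \<eta> (\<lambda>x. A n (\<tau> (B n x)))) sums \<phi> \<eta> \<tau>"
    if \<eta>: "hilbert_schmidt \<eta>" and \<tau>: "hilbert_schmidt \<tau>" for \<eta> \<tau>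
  proof (rule sums_pairs)
    let ?T = "\<lambda>n. hs_inner \<eta> (\<lambda>x. A n (\<tau> (B n x)))"
    let ?c = "\<lambda>\<sigma> i j. cinner (e i) (\<sigma> (f j))"
    have flip: "cinner (\<eta> (f i)) (e j) = cnj (?c \<eta> j i)" for i j
      by (rule cinner_commute)
    \<comment> \<open>\<open>?x1\<close> and \<open>?x4\<close> are the two summands of the pair;
      \<open>?x2\<close> and \<open>?x3\<close> are cross terms that appear with opposite signs in
      the even and the odd entry.\<close>
    let ?x1 = "\<lambda>q. t q * (cnj (?c \<eta> (mm q) (mm q)) * ?c \<tau> (nn q) (nn q))"
      and ?x2 = "\<lambda>q. cnj (t q) * (cnj (?c \<eta> (nn q) (mm q)) * ?c \<tau> (mm q) (nn q))"
      and ?x3 = "\<lambda>q. t q * (cnj (?c \<eta> (mm q) (nn q)) * ?c \<tau> (nn q) (mm q))"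
      and ?x4 = "\<lambda>q. cnj (t q) * (cnj (?c \<eta> (nn q) (nn q)) * ?c \<tau> (mm q) (mm q))"
    have ii: "\<i> * z * \<i> = - z" for z
      using mult.assoc[of \<i> \<i> z] by (simp only: mult.commute[of "\<i> * z"] i_squared mult_minus1)
    have half: "(x + y + z + w) / 2 + (x - y - z + w) / 2 = x + w" for x y z w :: complex
      by (simp add: field_simps)
    have T_even: "?T (2 * q) = (?x1 q + ?x2 q + ?x3 q + ?x4 q) / 2" for q
      by (simp add: A_def B_def hs_inner_rank2_sandwich_scaleC[OF \<eta> \<tau>] flip add_divide_distrib)
    have T_odd: "?T (Suc (2 * q)) = (?x1 q - ?x2 q - ?x3 q + ?x4 q) / 2" for q
      by (simp add: A_def B_def hs_inner_rank2_sandwich_scaleC[OF \<eta> \<tau>] flip add_divide_distrib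
          diff_divide_distrib ii)
    have "?T (2 * q) + ?T (Suc (2 * q)) = ?x1 q + ?x4 q" for q
      by (simp only: T_even T_odd half)
    moreover have "?x1 q + ?x4 q = (case prod_decode q of (m, k) \<Rightarrow> pair \<phi> \<eta> \<tau> (m + k) m)" for q
      by (simp add: pair_def coeff_def t_def mm_def nn_def case_prod_unfold mult.assoc)
    ultimately have "?T (2 * q) + ?T (Suc (2 * q)) = (case prod_decode q of (m, k) \<Rightarrow> pair \<phi> \<eta> \<tau> (m + k) m)" for q
      by simp
    then show "(\<lambda>q. ?T (2 * q) + ?T (Suc (2 * q))) sums \<phi> \<eta> \<tau>"
      using pair_sums[OF \<phi> herm \<eta> \<tau>] by simp
    define Q where "Q = {q. mm q \<in> J \<and> nn q \<in> J}"
    define P where "P i j k l = (\<lambda>q. cmod (?c \<eta> (i q) (j q)) * cmod (?c \<tau> (k q) (l q)))"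
      for i j k l :: "nat \<Rightarrow> nat"
    have QJ: "mm q \<in> J" "nn q \<in> J" if "q \<in> Q" for q using that by (auto simp: Q_def)
    have eq: "q = q'" if "q \<in> Q" "q' \<in> Q" "e (mm q) = e (mm q')" "f (mm q) = f (mm q')"
      "e (nn q) = e (nn q')" "f (nn q) = f (nn q')" for q q'
      by (rule inj_mn[OF inj inj]) (rule QJ that)+
    have null: "P i j k l \<longlonglongrightarrow> 0"
      if "\<And>q. q \<in> Q \<Longrightarrow> i q \<in> J \<and> j q \<in> J \<and> k q \<in> J \<and> l q \<in> J"
        and "\<And>q. q \<notin> Q \<Longrightarrow> i q \<notin> J \<or> k q \<notin> J"
        and "\<And>q q'. q \<in> Q \<Longrightarrow> q' \<in> Q \<Longrightarrow> e (i q) = e (i q') \<Longrightarrow> f (j q) = f (j q') \<Longrightarrow>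
          e (k q) = e (k q') \<Longrightarrow> f (l q) = f (l q') \<Longrightarrow> q = q'" for i j k l
      unfolding P_def
    proof (rule coeff_product_tendsto_zero[OF \<eta> \<tau>])
      show "e (i q) \<in> the_onb \<and> f (j q) \<in> the_onb \<and> e (k q) \<in> the_onb \<and> f (l q) \<in> the_onb"
        if "q \<in> Q" for q
        using \<open>\<And>q. q \<in> Q \<Longrightarrow> i q \<in> J \<and> j q \<in> J \<and> k q \<in> J \<and> l q \<in> J\<close>[OF that] in_onb by simp
      show "e (i q) = 0 \<or> e (k q) = 0" if "q \<notin> Q" for q
        using \<open>\<And>q. q \<notin> Q \<Longrightarrow> i q \<notin> J \<or> k q \<notin> J\<close>[OF that] zero(1) by blast
      show "inj_on (\<lambda>q. ((e (i q), f (j q)), (e (k q), f (l q)))) Q"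
        by (rule inj_onI) (simp add: that(3))
    qed
    \<comment> \<open>In each of the four products the indices of the two \<open>e\<close> vectors
      are \<open>mm\<close> and \<open>nn\<close> in some order, and so are those of the two
      \<open>f\<close> vectors. Hence the quadruple determines \<open>q\<close>, and outside
      \<open>Q\<close> one of the \<open>e\<close> vectors is zero.\<close>
    have P: "P mm mm nn nn \<longlonglongrightarrow> 0" "P nn mm mm nn \<longlonglongrightarrow> 0" "P mm nn nn mm \<longlonglongrightarrow> 0" "P nn nn mm mm \<longlonglongrightarrow> 0"
      by (rule null, simp add: QJ, force simp: Q_def, rule eq; assumption)+
    show "(\<lambda>q. ?T (2 * q)) \<longlonglongrightarrow> 0"
    proof (rule Lim_null_comparison[OF always_eventually], rule allI)
      fix q
      have *: "cmod (s * (cnj x * y)) \<le> K * (cmod x * cmod y)" if "cmod s \<le> K" for s x y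
        using mult_right_mono[OF that, of "cmod x * cmod y"] by (simp add: norm_mult)
      have "cmod (?T (2 * q)) * 2 \<le> K * P mm mm nn nn q + K * P nn mm mm nn q + K * P mm nn nn mm q + K * P nn nn mm mm q"
      proof -
        have "cmod (?x1 q + ?x2 q + ?x3 q + ?x4 q)
            \<le> K * P mm mm nn nn q + K * P nn mm mm nn q + K * P mm nn nn mm q + K * P nn nn mm mm q"
          unfolding P_def by (intro norm_triangle_le add_mono *) (simp_all only: complex_mod_cnj tK)
        then show ?thesis unfolding T_even norm_divide by simp
      qed
      then show "norm (?T (2 * q)) \<le> (K * P mm mm nn nn q + K * P nn mm mm nn q + K * P mm nn nn mm q + K * P nn nn mm mm q) / 2"
        by simp
    next
      have "(\<lambda>q. (K * P mm mm nn nn q + K * P nn mm mm nn q + K * P mm nn nn mm q + K * P nn nn mm mm q) / 2)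
          \<longlonglongrightarrow> (K * 0 + K * 0 + K * 0 + K * 0) / 2"
        by (intro tendsto_intros P) simp
      then show "(\<lambda>q. (K * P mm mm nn nn q + K * P nn mm mm nn q + K * P mm nn nn mm q + K * P nn nn mm mm q) / 2) \<longlonglongrightarrow> 0"
        by simp
    qed
  qed
  have "selfadjoint_op (A n)" "selfadjoint_op (B n)" for n
    by (simp_all add: A_def B_def selfadjoint_rank2)
  then show ?thesis
    by (intro exI[of _ A] exI[of _ B] conjI allI impI main)
qed

end

text \<open>\<open>to_nat_on\<close> embeds the countable set of pairs into the naturals whether it
  is finite or infinite; \<open>J\<close> is the image, and both sequences are set to zero off
  it.\<close>

lemma ex_hs_enum:
  assumes "separable_type TYPE('a::chilbert_space)"
  shows "\<exists>(e :: nat \<Rightarrow> 'a) f J. hs_enum e f J"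
proof -
  let ?P = "the_onb \<times> the_onb :: ('a \<times> 'a) set"
  have "countable ?P"
    using orthonormal_countable[OF assms orthonormal_the_onb] by simp
  then have inj: "inj_on (to_nat_on ?P) ?P" by (rule inj_on_to_nat_on)
  define J where "J = to_nat_on ?P ` ?P"
  define p where "p = inv_into ?P (to_nat_on ?P)"
  have "bij_betw p J ?P"
    unfolding J_def p_def by (rule bij_betw_inv_into) (use inj in \<open>simp add: bij_betw_def\<close>)
  then have "bij_betw (\<lambda>n. (if n \<in> J then fst (p n) else 0, if n \<in> J then snd (p n) else 0)) J ?P"
    by (rule bij_betw_cong[THEN iffD1, rotated]) simp
  then have "hs_enum (\<lambda>n. if n \<in> J then fst (p n) else 0) (\<lambda>n. if n \<in> J then snd (p n) else 0) J"
    by unfold_locales simp_all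
  then show ?thesis by blast
qed

section \<open>Representation of sesquilinear forms\<close>

text \<open>The operator demanded by \<open>sesq_rep\<close> is the one that represents
  \<open>\<phi>\<close>, so its two series conditions become the same one.\<close>

lemma sesq_repI:
  fixes \<phi> :: "('a::chilbert_space \<Rightarrow> 'a) \<Rightarrow> ('a \<Rightarrow> 'a) \<Rightarrow> complex"
  assumes "cont_sesq_form \<phi>" "\<And>n. bounded_op (a n)" "\<And>n. bounded_op (b n)"
    and "\<And>\<eta> \<tau>. hilbert_schmidt \<eta> \<Longrightarrow> hilbert_schmidt \<tau> \<Longrightarrow>
      (\<lambda>n. hs_inner \<eta> (\<lambda>x. a n (\<tau> (b n x)))) sums \<phi> \<eta> \<tau>"
  shows "sesq_rep \<phi> a b"
proof -
  obtain T where "bounded_op_S2 T"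
    "\<forall>\<eta> \<tau>. hilbert_schmidt \<eta> \<longrightarrow> hilbert_schmidt \<tau> \<longrightarrow> hs_inner \<eta> (T \<tau>) = \<phi> \<eta> \<tau>"
    using form_operator[OF assms(1)] by auto
  with assms show ?thesis
    unfolding sesq_rep_def trace_eq_hs_inner by (intro conjI allI exI[of _ T]) auto
qed

lemma hermitian_form_commute:
  fixes \<phi> :: "('a::chilbert_space \<Rightarrow> 'a) \<Rightarrow> ('a \<Rightarrow> 'a) \<Rightarrow> complex"
  assumes "hermitian_form \<phi>" "hilbert_schmidt \<eta>" "hilbert_schmidt \<tau>"
  shows "cnj (\<phi> \<eta> \<tau>) = \<phi> \<tau> \<eta>"
proof -
  obtain T where T: "bounded_op_S2 T" "selfadjoint_S2 T"
    "\<forall>\<eta> \<tau>. hilbert_schmidt \<eta> \<longrightarrow> hilbert_schmidt \<tau> \<longrightarrow> \<phi> \<eta> \<tau> = hs_inner \<eta> (T \<tau>)"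
    using assms(1) by (auto simp: hermitian_form_def)
  have hs: "hilbert_schmidt (T \<tau>)"
    using T(1) assms(3) by (simp add: bounded_op_S2_def)
  have "cnj (\<phi> \<eta> \<tau>) = hs_inner (T \<tau>) \<eta>"
    using T(3) assms hs_inner_commute[OF hs assms(2)] by simp
  also have "\<dots> = \<phi> \<tau> \<eta>"
    using T(2,3) assms by (simp add: selfadjoint_S2_def)
  finally show ?thesis .
qed

text \<open>Every term is a hermitian form, and this passes to the sum because conjugation is
  continuous. The operator from \<open>sesq_rep\<close> then serves as witness, uniqueness of limits
  identifying its form with \<open>\<phi>\<close>.\<close>

lemma selfadjoint_rep_hermitian:
  fixes \<phi> :: "('a::chilbert_space \<Rightarrow> 'a) \<Rightarrow> ('a \<Rightarrow> 'a) \<Rightarrow> complex"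
  assumes "sesq_rep \<phi> a b" and sa: "\<And>n. selfadjoint_op (a n)" "\<And>n. selfadjoint_op (b n)"
  shows "hermitian_form \<phi>"
proof -
  obtain T where T: "bounded_op_S2 T"
    and sums: "\<And>\<eta> \<tau>. hilbert_schmidt \<eta> \<Longrightarrow> hilbert_schmidt \<tau> \<Longrightarrow>
      (\<lambda>n. hs_inner \<eta> (\<lambda>x. a n (\<tau> (b n x)))) sums hs_inner \<eta> (T \<tau>) \<and>
      (\<lambda>n. hs_inner \<eta> (\<lambda>x. a n (\<tau> (b n x)))) sums \<phi> \<eta> \<tau>"
    using assms(1) unfolding sesq_rep_def trace_eq_hs_inner by blast
  have "hs_inner (T \<eta>) \<tau> = hs_inner \<eta> (T \<tau>)"
    if \<eta>: "hilbert_schmidt \<eta>" and \<tau>: "hilbert_schmidt \<tau>" for \<eta> \<tau>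
  proof -
    have hs: "hilbert_schmidt (T \<eta>)"
      using T \<eta> by (simp add: bounded_op_S2_def)
    have "(\<lambda>n. cnj (hs_inner \<tau> (\<lambda>x. a n (\<eta> (b n x))))) sums cnj (hs_inner \<tau> (T \<eta>))"
      using sums[OF \<tau> \<eta>] by (simp add: sums_cnj)
    then have "(\<lambda>n. hs_inner \<eta> (\<lambda>x. a n (\<tau> (b n x)))) sums hs_inner (T \<eta>) \<tau>"
      by (simp add: hs_inner_sandwich[OF \<eta> \<tau> sa] hs_inner_commute[OF hs \<tau>])
    then show ?thesis using sums[OF \<eta> \<tau>] sums_unique2 by blast
  qed
  moreover have "\<phi> \<eta> \<tau> = hs_inner \<eta> (T \<tau>)" if "hilbert_schmidt \<eta>" "hilbert_schmidt \<tau>" for \<eta> \<tau>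
    using sums[OF that] sums_unique2 by blast
  ultimately show ?thesis
    using T unfolding hermitian_form_def selfadjoint_S2_def by blast
qed

lemma ex_sesq_rep:
  fixes \<phi> :: "('a::chilbert_space \<Rightarrow> 'a) \<Rightarrow> ('a \<Rightarrow> 'a) \<Rightarrow> complex"
  assumes "separable_type TYPE('a)" and \<phi>: "cont_sesq_form \<phi>"
  shows "\<exists>a b. sesq_rep \<phi> a b"
proof -
  obtain e f J where enum: "hs_enum (e :: nat \<Rightarrow> 'a) f J" using ex_hs_enum[OF assms(1)] by blast
  define \<phi>1 where "\<phi>1 = (\<lambda>\<eta> \<tau>. (1/2) * \<phi> \<eta> \<tau> + (1/2) * cnj (\<phi> \<tau> \<eta>))"
  define \<phi>2 where "\<phi>2 = (\<lambda>\<eta> \<tau>. (- \<i>/2) * \<phi> \<eta> \<tau> + (\<i>/2) * cnj (\<phi> \<tau> \<eta>))"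
  have forms: "cont_sesq_form \<phi>1" "cont_sesq_form \<phi>2"
    unfolding \<phi>1_def \<phi>2_def by (rule cont_sesq_form_lincomb[OF \<phi> cont_sesq_form_swap[OF \<phi>]])+
  have herm: "cnj (\<phi>1 \<eta> \<tau>) = \<phi>1 \<tau> \<eta>" "cnj (\<phi>2 \<eta> \<tau>) = \<phi>2 \<tau> \<eta>" for \<eta> \<tau>
    by (simp_all add: \<phi>1_def \<phi>2_def)
  obtain a1 b1 where 1: "\<And>n. selfadjoint_op (a1 n)" "\<And>n. selfadjoint_op (b1 n)"
    "\<And>\<eta> \<tau>. hilbert_schmidt \<eta> \<Longrightarrow> hilbert_schmidt \<tau> \<Longrightarrow>
      (\<lambda>n. hs_inner \<eta> (\<lambda>x. a1 n (\<tau> (b1 n x)))) sums \<phi>1 \<eta> \<tau>"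
    using hs_enum.hermitian_selfadjoint_sums[OF enum forms(1) herm(1)] by blast
  obtain a2 b2 where 2: "\<And>n. selfadjoint_op (a2 n)" "\<And>n. selfadjoint_op (b2 n)"
    "\<And>\<eta> \<tau>. hilbert_schmidt \<eta> \<Longrightarrow> hilbert_schmidt \<tau> \<Longrightarrow>
      (\<lambda>n. hs_inner \<eta> (\<lambda>x. a2 n (\<tau> (b2 n x)))) sums \<phi>2 \<eta> \<tau>"
    using hs_enum.hermitian_selfadjoint_sums[OF enum forms(2) herm(2)] by blast
  \<comment> \<open>The two series are interleaved. The factor \<i> of the second part goes into its
    left factors, which in general stop being self-adjoint.\<close>
  define a where "a n = (if even n then a1 (n div 2) else (\<lambda>x. \<i> *\<^sub>C a2 (n div 2) x))" for n
  define b where "b n = (if even n then b1 (n div 2) else b2 (n div 2))" for n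
  have "sesq_rep \<phi> a b"
  proof (rule sesq_repI[OF \<phi>])
    show "bounded_op (a n)" "bounded_op (b n)" for n
      using 1 2 by (simp_all add: a_def b_def selfadjoint_bounded bounded_op_mult)
    fix \<eta> \<tau> :: "'a \<Rightarrow> 'a"
    assume \<eta>: "hilbert_schmidt \<eta>" and \<tau>: "hilbert_schmidt \<tau>"
    show "(\<lambda>n. hs_inner \<eta> (\<lambda>x. a n (\<tau> (b n x)))) sums \<phi> \<eta> \<tau>"
    proof (rule sums_pairs)
      note s1 = 1(3)[OF \<eta> \<tau>] and s2 = 2(3)[OF \<eta> \<tau>]
      have "hs_inner \<eta> (\<lambda>x. \<i> *\<^sub>C a2 n (\<tau> (b2 n x))) = \<i> * hs_inner \<eta> (\<lambda>x. a2 n (\<tau> (b2 n x)))" for n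
        by (simp add: hs_inner_eq[OF hs_bounded[OF \<eta>]] cinner_scaleC_right infsum_cmult_right')
      then have "hs_inner \<eta> (\<lambda>x. a (2 * q) (\<tau> (b (2 * q) x)))
          + hs_inner \<eta> (\<lambda>x. a (Suc (2 * q)) (\<tau> (b (Suc (2 * q)) x)))
          = hs_inner \<eta> (\<lambda>x. a1 q (\<tau> (b1 q x))) + \<i> * hs_inner \<eta> (\<lambda>x. a2 q (\<tau> (b2 q x)))" for q
        by (simp add: a_def b_def)
      moreover have "\<phi>1 \<eta> \<tau> + \<i> * \<phi>2 \<eta> \<tau> = \<phi> \<eta> \<tau>"
        by (simp add: \<phi>1_def \<phi>2_def algebra_simps)
      ultimately show "(\<lambda>q. hs_inner \<eta> (\<lambda>x. a (2 * q) (\<tau> (b (2 * q) x)))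
          + hs_inner \<eta> (\<lambda>x. a (Suc (2 * q)) (\<tau> (b (Suc (2 * q)) x)))) sums \<phi> \<eta> \<tau>"
        using sums_add[OF s1 sums_mult[OF s2, of \<i>]] by simp
      \<comment> \<open>The even entries are the terms of the convergent series for
        \<open>\<phi>1\<close>.\<close>
      show "(\<lambda>q. hs_inner \<eta> (\<lambda>x. a (2 * q) (\<tau> (b (2 * q) x)))) \<longlonglongrightarrow> 0"
        using summable_LIMSEQ_zero[OF sums_summable[OF s1]] by (simp add: a_def b_def)
    qed
  qed
  then show ?thesis by blast
qed

theorem theorem3p18:
  fixes \<phi> :: "('a::chilbert_space \<Rightarrow> 'a) \<Rightarrow> ('a \<Rightarrow> 'a) \<Rightarrow> complex"
  assumes "separable_type TYPE('a)"
    and "cont_sesq_form \<phi>"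
  shows "(\<exists>a b. sesq_rep \<phi> a b) \<and>
         (hermitian_form \<phi> \<longleftrightarrow>
            (\<exists>a b. sesq_rep \<phi> a b \<and> (\<forall>n. selfadjoint_op (a n) \<and> selfadjoint_op (b n))))"
proof (intro conjI iffI)
  show "\<exists>a b. sesq_rep \<phi> a b" by (rule ex_sesq_rep[OF assms])
next
  assume h: "hermitian_form \<phi>"
  obtain e f J where "hs_enum (e :: nat \<Rightarrow> 'a) f J" using ex_hs_enum[OF assms(1)] by blast
  from hs_enum.hermitian_selfadjoint_sums[OF this assms(2) hermitian_form_commute[OF h]]
  obtain a b where ab: "\<And>n. selfadjoint_op (a n)" "\<And>n. selfadjoint_op (b n)"
    "\<And>\<eta> \<tau>. hilbert_schmidt \<eta> \<Longrightarrow> hilbert_schmidt \<tau> \<Longrightarrow>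
      (\<lambda>n. hs_inner \<eta> (\<lambda>x. a n (\<tau> (b n x)))) sums \<phi> \<eta> \<tau>" by blast
  have "sesq_rep \<phi> a b"
    by (rule sesq_repI[OF assms(2) ab(1,2)[THEN selfadjoint_bounded] ab(3)])
  with ab show "\<exists>a b. sesq_rep \<phi> a b \<and> (\<forall>n. selfadjoint_op (a n) \<and> selfadjoint_op (b n))" by blast
next
  assume "\<exists>a b. sesq_rep \<phi> a b \<and> (\<forall>n. selfadjoint_op (a n) \<and> selfadjoint_op (b n))"
  then show "hermitian_form \<phi>" using selfadjoint_rep_hermitian by blast
qed

end
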